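(* Let $\mathcal C$ be a class of graphs with an excluded minor. Then the restriction of Minimum Vertex Cover to instances in $\mathcal C$ has a polynomial time approximation scheme (PTAS).
   Context: Graphs are finite, simple and undirected; $V^G$ and $E^G$ denote the vertex and edge sets of $G$. A minor of $G$ is a graph $H$ that can be obtained from a subgraph of $G$ by contracting edges; write $H\preceq G$. A class $\mathcal C$ of graphs has an excluded minor if there is a graph $H$ such that $H\not\preceq G$ for all $G\in\mathcal C$. Minimum Vertex Cover: instances are graphs $G$; solutions are vertex covers, i.e. sets $X\subseteq V^G$ such that for every edge $vw\in E^G$ either $v\in X$ or $w\in X$; the cost is $C(G,X):=|X|$; the goal is $\min$. Let $\mathrm{opt}(G)$ be the minimum cost of a solution for $G$. For $\epsilon>0$, a solution $X$ for $G$ is $\epsilon$-close if $(1-\epsilon)\,\mathrm{opt}(G)\le C(G,X)\le(1+\epsilon)\,\mathrm{opt}(G)$. A PTAS for the restriction to instances in $\mathcal C$ is a uniform family $(A_\epsilon)_{\epsilon>0}$, where $A_\epsilon$ is a polynomial time algorithm that, given $G\in\mathcal C$, computes an $\epsilon$-close solution for $G$; uniformity means that there is an algorithm that, given $\epsilon$, computes $A_\epsilon$. *)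

theory Defs
  imports Complex_Main "HOL-Computational_Algebra.Polynomial"
begin

section \<open>Graphs and minors\<close>

type_synonym 'a graph = "'a set \<times> 'a set set"

abbreviation verts :: "'a graph \<Rightarrow> 'a set" where "verts \<equiv> fst"
abbreviation edges :: "'a graph \<Rightarrow> 'a set set" where "edges \<equiv> snd"

definition simple_graph :: "'a graph \<Rightarrow> bool" where
  "simple_graph G \<longleftrightarrow> finite (verts G) \<and> (\<forall>e \<in> edges G. e \<subseteq> verts G \<and> card e = 2)"

definition subgraph :: "'a graph \<Rightarrow> 'a graph \<Rightarrow> bool" where
  "subgraph G' G \<longleftrightarrow> simple_graph G' \<and> verts G' \<subseteq> verts G \<and> edges G' \<subseteq> edges G"

text \<open>The contracted edge \<open>{v, w}\<close> becomes the vertex \<open>v\<close>. No loops arise, since \<open>{v, w}\<close>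
  is removed, and parallel edges are merged because edges form a set.\<close>

definition contract_edge :: "'a graph \<Rightarrow> 'a \<Rightarrow> 'a \<Rightarrow> 'a graph" where
  "contract_edge G v w =
     (verts G - {w}, (\<lambda>e. (id(w := v)) ` e) ` (edges G - {{v, w}}))"

definition contraction_step :: "'a graph \<Rightarrow> 'a graph \<Rightarrow> bool" where
  "contraction_step G G' \<longleftrightarrow> (\<exists>v w. {v, w} \<in> edges G \<and> G' = contract_edge G v w)"

definition graph_iso :: "'a graph \<Rightarrow> 'b graph \<Rightarrow> bool" where
  "graph_iso G H \<longleftrightarrow>
     (\<exists>f. bij_betw f (verts G) (verts H) \<and> edges H = (\<lambda>e. f ` e) ` edges G)"

definition minor :: "'b graph \<Rightarrow> 'a graph \<Rightarrow> bool" where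
  "minor H G \<longleftrightarrow>
     (\<exists>G' G''. subgraph G' G \<and> contraction_step\<^sup>*\<^sup>* G' G'' \<and> graph_iso G'' H)"

text \<open>Every finite graph is isomorphic to one on natural numbers, so it is no restriction to
  take the excluded graph there.\<close>

definition has_excluded_minor :: "'a graph set \<Rightarrow> bool" where
  "has_excluded_minor C \<longleftrightarrow> (\<exists>H :: nat graph. simple_graph H \<and> (\<forall>G \<in> C. \<not> minor H G))"


section \<open>Minimum Vertex Cover\<close>

definition vertex_cover :: "'a graph \<Rightarrow> 'a set \<Rightarrow> bool" where
  "vertex_cover G X \<longleftrightarrow> X \<subseteq> verts G \<and> (\<forall>v w. {v, w} \<in> edges G \<longrightarrow> v \<in> X \<or> w \<in> X)"

definition opt :: "'a graph \<Rightarrow> nat" where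
  "opt G = Min (card ` {X. vertex_cover G X})"

definition close_solution :: "real \<Rightarrow> 'a graph \<Rightarrow> 'a set \<Rightarrow> bool" where
  "close_solution \<epsilon> G X \<longleftrightarrow> vertex_cover G X \<and>
     (1 - \<epsilon>) * real (opt G) \<le> real (card X) \<and> real (card X) \<le> (1 + \<epsilon>) * real (opt G)"


section \<open>Algorithms and running time\<close>

text \<open>The machine model is a WHILE language on binary trees in the style of N. D. Jones. Its
  cost measure is not unit cost: an expression is charged the size of the value of each of its
  subexpressions, as if all values were copied in full. All data written during a run
  of time \<open>t\<close> therefore have total size at most \<open>t\<close>, so these programs and Turing machines
  simulate each other with polynomial overhead.\<close>

datatype tree = Leaf | Node tree tree

fun left :: "tree \<Rightarrow> tree" where
  "left Leaf = Leaf"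
| "left (Node a b) = a"

fun right :: "tree \<Rightarrow> tree" where
  "right Leaf = Leaf"
| "right (Node a b) = b"

fun nodes :: "tree \<Rightarrow> nat" where
  "nodes Leaf = 1"
| "nodes (Node a b) = 1 + nodes a + nodes b"

datatype expr =
    ELeaf
  | EVar nat
  | ENode expr expr
  | ELeft expr
  | ERight expr
  | EEq expr expr

type_synonym state = "nat \<Rightarrow> tree"

fun val :: "expr \<Rightarrow> state \<Rightarrow> tree" where
  "val ELeaf s = Leaf"
| "val (EVar x) s = s x"
| "val (ENode d e) s = Node (val d s) (val e s)"
| "val (ELeft e) s = left (val e s)"
| "val (ERight e) s = right (val e s)"
| "val (EEq d e) s = (if val d s = val e s then Node Leaf Leaf else Leaf)"

fun etime :: "expr \<Rightarrow> state \<Rightarrow> nat" where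
  "etime ELeaf s = 1"
| "etime (EVar x) s = nodes (s x)"
| "etime (ENode d e) s = etime d s + etime e s + nodes (val (ENode d e) s)"
| "etime (ELeft e) s = etime e s + nodes (val (ELeft e) s)"
| "etime (ERight e) s = etime e s + nodes (val (ERight e) s)"
| "etime (EEq d e) s = etime d s + etime e s + nodes (val (EEq d e) s)"

datatype prog =
    Assign nat expr
  | Seq prog prog
  | If expr prog prog
  | While expr prog

text \<open>\<open>exec p s t s'\<close>: started in \<open>s\<close>, the program \<open>p\<close> halts after time \<open>t\<close> in \<open>s'\<close>. A condition
  counts as false iff its value is \<open>Leaf\<close>.\<close>

inductive exec :: "prog \<Rightarrow> state \<Rightarrow> nat \<Rightarrow> state \<Rightarrow> bool" where
  Assign: "exec (Assign x e) s (1 + etime e s) (s(x := val e s))"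
| Seq: "\<lbrakk>exec p s t s'; exec q s' u s''\<rbrakk> \<Longrightarrow> exec (Seq p q) s (t + u) s''"
| IfTrue: "\<lbrakk>val e s \<noteq> Leaf; exec p s t s'\<rbrakk>
    \<Longrightarrow> exec (If e p q) s (1 + etime e s + t) s'"
| IfFalse: "\<lbrakk>val e s = Leaf; exec q s t s'\<rbrakk>
    \<Longrightarrow> exec (If e p q) s (1 + etime e s + t) s'"
| WhileFalse: "val e s = Leaf \<Longrightarrow> exec (While e p) s (1 + etime e s) s"
| WhileTrue: "\<lbrakk>val e s \<noteq> Leaf; exec p s t s'; exec (While e p) s' u s''\<rbrakk>
    \<Longrightarrow> exec (While e p) s (1 + etime e s + t + u) s''"

inductive_cases exec_AssignE: "exec (Assign x e) s t s'"
inductive_cases exec_SeqE: "exec (Seq p q) s t s'"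
inductive_cases exec_IfE: "exec (If e p q) s t s'"
inductive_cases exec_WhileE: "exec (While e p) s t s'"

lemma exec_deterministic:
  "exec p s t s' \<Longrightarrow> exec p s u s'' \<Longrightarrow> t = u \<and> s' = s''"
proof (induction arbitrary: u s'' rule: exec.induct)
  case (Assign x e s)
  then show ?case by (auto elim: exec_AssignE)
next
  case (Seq p s t s' q v s1)
  from Seq.prems show ?case
    by (rule exec_SeqE) (use Seq.IH in metis)
next
  case (IfTrue e s p t s' q)
  from IfTrue.prems show ?case
    by (rule exec_IfE; use IfTrue.hyps(1) in \<open>auto dest!: IfTrue.IH\<close>)
next
  case (IfFalse e s q t s' p)
  from IfFalse.prems show ?case
    by (rule exec_IfE; use IfFalse.hyps(1) in \<open>auto dest!: IfFalse.IH\<close>)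
next
  case (WhileFalse e s p)
  from WhileFalse.prems show ?case
    by (rule exec_WhileE) (use WhileFalse.hyps in auto)
next
  case (WhileTrue e s p t s' v s1)
  from WhileTrue.prems show ?case
    by (rule exec_WhileE; use WhileTrue.hyps(1) in \<open>auto dest!: WhileTrue.IH\<close>)
qed

text \<open>Input and output are in variable 0; all other variables are initially \<open>Leaf\<close>.\<close>

definition runs :: "prog \<Rightarrow> tree \<Rightarrow> nat \<Rightarrow> tree \<Rightarrow> bool" where
  "runs p x t y \<longleftrightarrow> (\<exists>s'. exec p ((\<lambda>_. Leaf)(0 := x)) t s' \<and> s' 0 = y)"

definition outputs :: "prog \<Rightarrow> tree \<Rightarrow> tree \<Rightarrow> bool" where
  "outputs p x y \<longleftrightarrow> (\<exists>t. runs p x t y)"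

definition polynomial_time :: "prog \<Rightarrow> bool" where
  "polynomial_time p \<longleftrightarrow>
     (\<exists>b :: nat poly. \<forall>x. \<exists>t y. runs p x t y \<and> t \<le> poly b (nodes x))"


section \<open>Encodings\<close>

text \<open>Binary notation, least significant bit first; \<open>Leaf\<close> is the bit 0 and
  \<open>Node Leaf Leaf\<close> the bit 1.\<close>

fun code_nat :: "nat \<Rightarrow> tree" where
  "code_nat n =
     (if n = 0 then Leaf
      else Node (if odd n then Node Leaf Leaf else Leaf) (code_nat (n div 2)))"

declare code_nat.simps [simp del]

fun code_pair :: "nat \<times> nat \<Rightarrow> tree" where
  "code_pair (m, n) = Node (code_nat m) (code_nat n)"

fun code_list :: "('a \<Rightarrow> tree) \<Rightarrow> 'a list \<Rightarrow> tree" where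
  "code_list c [] = Leaf"
| "code_list c (x # xs) = Node (c x) (code_list c xs)"

text \<open>A positive rational is given by its reduced numerator and denominator.\<close>

definition code_rat :: "rat \<Rightarrow> tree" where
  "code_rat q = code_pair (nat (fst (quotient_of q)), nat (snd (quotient_of q)))"

text \<open>Sets and graphs have several codes, one for each enumeration without repetitions.\<close>

definition codes_set :: "tree \<Rightarrow> nat set \<Rightarrow> bool" where
  "codes_set t X \<longleftrightarrow> (\<exists>xs. distinct xs \<and> set xs = X \<and> t = code_list code_nat xs)"

definition codes_graph :: "tree \<Rightarrow> nat graph \<Rightarrow> bool" where
  "codes_graph t G \<longleftrightarrow> (\<exists>vs es.
     distinct vs \<and> set vs = verts G \<and>
     distinct (map (\<lambda>(v, w). {v, w}) es) \<and> set (map (\<lambda>(v, w). {v, w}) es) = edges G \<and>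
     t = Node (code_list code_nat vs) (code_list code_pair es))"

fun code_expr :: "expr \<Rightarrow> tree" where
  "code_expr ELeaf = Node (code_nat 0) Leaf"
| "code_expr (EVar x) = Node (code_nat 1) (code_nat x)"
| "code_expr (ENode d e) = Node (code_nat 2) (Node (code_expr d) (code_expr e))"
| "code_expr (ELeft e) = Node (code_nat 3) (code_expr e)"
| "code_expr (ERight e) = Node (code_nat 4) (code_expr e)"
| "code_expr (EEq d e) = Node (code_nat 5) (Node (code_expr d) (code_expr e))"

fun code_prog :: "prog \<Rightarrow> tree" where
  "code_prog (Assign x e) = Node (code_nat 0) (Node (code_nat x) (code_expr e))"
| "code_prog (Seq p q) = Node (code_nat 1) (Node (code_prog p) (code_prog q))"
| "code_prog (If e p q) =
     Node (code_nat 2) (Node (code_expr e) (Node (code_prog p) (code_prog q)))"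
| "code_prog (While e p) = Node (code_nat 3) (Node (code_expr e) (code_prog p))"

lemma code_nat_inject [simp]: "code_nat m = code_nat n \<longleftrightarrow> m = n"
proof
  show "code_nat m = code_nat n \<Longrightarrow> m = n"
  proof (induction m arbitrary: n rule: less_induct)
    case (less m)
    show ?case
    proof (cases "m = 0 \<or> n = 0")
      case True
      with less.prems show ?thesis
        by (auto simp: code_nat.simps [of m] code_nat.simps [of n] split: if_splits)
    next
      case False
      with less.prems have "odd m \<longleftrightarrow> odd n" "code_nat (m div 2) = code_nat (n div 2)"
        by (auto simp: code_nat.simps [of m] code_nat.simps [of n] split: if_splits)
      with False less.IH [of "m div 2" "n div 2"] have "m div 2 = n div 2"
        by simp
      with \<open>odd m \<longleftrightarrow> odd n\<close> show ?thesis
        by presburger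
    qed
  qed
qed simp

lemma code_expr_inject: "code_expr d = code_expr e \<Longrightarrow> d = e"
  by (induction d arbitrary: e; case_tac e; simp)

lemma code_prog_inject: "code_prog p = code_prog q \<Longrightarrow> p = q"
  by (induction p arbitrary: q; case_tac q; simp add: code_expr_inject)


section \<open>Approximation schemes\<close>

definition approximates :: "prog \<Rightarrow> real \<Rightarrow> nat graph set \<Rightarrow> bool" where
  "approximates p \<epsilon> C \<longleftrightarrow> polynomial_time p \<and>
     (\<forall>G \<in> C. \<forall>x. codes_graph x G \<longrightarrow>
        (\<exists>y X. outputs p x y \<and> codes_set y X \<and> close_solution \<epsilon> G X))"

text \<open>The family is indexed by all positive reals; the algorithm witnessing uniformity receives
  a finite description of \<open>\<epsilon>\<close> and hence is applied to rational \<open>\<epsilon>\<close> only.\<close>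

definition is_ptas :: "(real \<Rightarrow> prog) \<Rightarrow> nat graph set \<Rightarrow> bool" where
  "is_ptas A C \<longleftrightarrow>
     (\<forall>\<epsilon> > 0. approximates (A \<epsilon>) \<epsilon> C) \<and>
     (\<exists>U. \<forall>q > 0. outputs U (code_rat q) (code_prog (A (of_rat q))))"

definition min_vertex_cover_has_ptas :: "nat graph set \<Rightarrow> bool" where
  "min_vertex_cover_has_ptas C \<longleftrightarrow> (\<exists>A. is_ptas A C)"

end

theory Submission imports Defs begin

text \<open>The scheme is local search: starting from the set of all vertices, pass to a smaller vertex
  cover as long as one can be found by changing at most \<open>R\<close> vertices. For fixed \<open>R\<close> this takes
  polynomial time; \<open>R\<close> only depends on \<open>\<epsilon>\<close> and on the excluded minor.

  Graphs without a \<open>K\<^sub>h\<close> minor have balanced separators of size \<open>O(\<surd>n)\<close> (Alon, Seymour and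
  Thomas). Separating recursively, one covers all edges of such a graph \<open>F\<close> by sets of bounded size
  whose total size is at most \<open>(1 + \<delta>) |F|\<close>. Let \<open>X\<close> be a local and \<open>Y\<close> a global optimum, and
  let \<open>F\<close> be induced by the symmetric difference of \<open>X\<close> and \<open>Y\<close>. For each set \<open>P\<close> of the
  covering, one may exchange the vertices of \<open>X - Y\<close> with all their \<open>F\<close>-neighbours in \<open>P\<close> for
  \<open>(Y - X) \<inter> P\<close>. Local optimality bounds the number of the former by the number of the latter, and
  summing over \<open>P\<close> gives \<open>|X| \<le> |Y| + \<delta> |F|\<close>.\<close>

section \<open>Polynomial-time functions on trees\<close>

text \<open>Uniformity dictates the shape of the algorithm: the text of the program for \<epsilon>
  must itself be computed. Hence the radius is a power \<open>2 ^ m\<close>, reached by squaring a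
  list of vertex lists \<open>m\<close> times. The program then consists of \<open>m\<close> nested
  copies of one fixed block followed by the search, and for rational \<epsilon> the number
  \<open>m\<close> is a constant plus twice the number of binary digits of the denominator. The
  excluded minor enters the algorithm through that constant only. Running times come from closure
  properties: all tree functions are total and built by composition, pairing, case distinction and
  folds, where one step of a fold may enlarge the accumulator only by an amount independent of its
  current size. Passing from the excluded graph to a clique is harmless, since a graph on
  \<open>h\<close> vertices is a subgraph of \<open>K\<^sub>h\<close>. Lack of a clique model is
  inherited by vertex subsets, so it is available for the symmetric difference and for every set met
  in the recursion. Connectedness is phrased by closed subsets, so that no walks have to be
  handled.\<close>

lemma poly_nat_mono: "m \<le> n \<Longrightarrow> poly q m \<le> poly q n" for q :: "nat poly"
  by (induction q) (auto simp: add_mono mult_mono)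

lemma nodes_pos [simp]: "0 < nodes x"
  by (cases x) auto

lemma nodes_left_le: "nodes (left x) \<le> nodes x"
  by (cases x) auto

lemma nodes_right_le: "nodes (right x) \<le> nodes x"
  by (cases x) auto

lemma nodes_val_le_etime: "nodes (val e s) \<le> etime e s"
  by (cases e) auto

text \<open>An assignment is charged at least the size of the value that it stores. Time therefore
  bounds the growth of data, which turns a time bound for one program into an input bound for the
  next.\<close>

lemma nodes_exec_le: "exec p s t s' \<Longrightarrow> nodes (s' i) \<le> nodes (s i) + t"
proof (induction rule: exec.induct)
  case (Assign x e s)
  then show ?case using nodes_val_le_etime[of e s] by auto
qed auto

text \<open>The input and the output are in register \<open>b\<close>, the registers below \<open>b\<close> are preserved,
  and those above \<open>b\<close> are scratch space with arbitrary initial contents.\<close>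

definition computes :: "nat \<Rightarrow> prog \<Rightarrow> (tree \<Rightarrow> tree) \<Rightarrow> nat poly \<Rightarrow> bool" where
  "computes b p f q \<longleftrightarrow> (\<forall>s. \<exists>t s'. exec p s t s' \<and> t \<le> poly q (nodes (s b)) \<and>
     s' b = f (s b) \<and> (\<forall>i<b. s' i = s i))"

text \<open>A program is demanded at every base register, because the combinators below place
  subprograms at \<open>b + 1\<close>, \<open>b + 2\<close> or \<open>b + 4\<close>, above the data
  that must survive.\<close>

definition ptime :: "(tree \<Rightarrow> tree) \<Rightarrow> bool" where
  "ptime f \<longleftrightarrow> (\<exists>q. \<forall>b. \<exists>p. computes b p f q)"

lemma computesE:
  assumes "computes b p f q"
  obtains t s' where "exec p s t s'" "t \<le> poly q (nodes (s b))" "s' b = f (s b)"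
    "\<And>i. i < b \<Longrightarrow> s' i = s i"
  using assms unfolding computes_def by metis

lemma computes_nodes_le:
  assumes "computes b p f q"
  shows "nodes (f x) \<le> nodes x + poly q (nodes x)"
proof -
  obtain t s' where *: "exec p (\<lambda>_. x) t s'" "t \<le> poly q (nodes x)" "s' b = f x"
    using computesE[OF assms, of "\<lambda>_. x"] by metis
  from nodes_exec_le[OF *(1), of b] *(2,3) show ?thesis by simp
qed

text \<open>The bound \<open>q'\<close> is evaluated at \<open>[:0, 1:] + q\<close>, the size that
  the intermediate value can reach.\<close>

lemma computes_comp:
  assumes "computes b p g q" "computes b p' f q'"
  shows "computes b (Seq p p') (\<lambda>x. f (g x)) (q + pcompose q' ([:0, 1:] + q))"
  unfolding computes_def
proof
  fix s :: state
  obtain t s' where 1: "exec p s t s'" "t \<le> poly q (nodes (s b))" "s' b = g (s b)"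
    "\<And>i. i < b \<Longrightarrow> s' i = s i"
    using computesE[OF assms(1), of s] by metis
  obtain t' s'' where 2: "exec p' s' t' s''" "t' \<le> poly q' (nodes (s' b))" "s'' b = f (s' b)"
    "\<And>i. i < b \<Longrightarrow> s'' i = s' i"
    using computesE[OF assms(2), of s'] by metis
  have "poly q' (nodes (s' b)) \<le> poly q' (nodes (s b) + poly q (nodes (s b)))"
    using computes_nodes_le[OF assms(1)] 1(3) by (intro poly_nat_mono) simp
  with 1 2 have "t + t' \<le> poly (q + pcompose q' ([:0, 1:] + q)) (nodes (s b))"
    by (simp add: poly_pcompose add.commute[of "nodes (s b)"])
  with 1 2 exec.Seq[OF 1(1) 2(1)]
  show "\<exists>t s'. exec (Seq p p') s t s' \<and> t \<le> poly (q + pcompose q' ([:0, 1:] + q)) (nodes (s b))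
      \<and> s' b = f (g (s b)) \<and> (\<forall>i<b. s' i = s i)"
    by (metis)
qed

lemma ptime_comp:
  assumes "ptime f" "ptime g"
  shows "ptime (\<lambda>x. f (g x))"
  using assms computes_comp unfolding ptime_def by meson

lemma computes_Assign:
  assumes "\<And>s. val e s = f (s b)" "\<And>s. Suc (etime e s) \<le> poly q (nodes (s b))"
  shows "computes b (Assign b e) f q"
  unfolding computes_def
proof
  fix s :: state
  from exec.Assign[of b e s] assms
  show "\<exists>t s'. exec (Assign b e) s t s' \<and> t \<le> poly q (nodes (s b)) \<and>
     s' b = f (s b) \<and> (\<forall>i<b. s' i = s i)"
    by (intro exI[of _ "1 + etime e s"] exI[of _ "s(b := val e s)"]) auto
qed

lemma ptime_id: "ptime (\<lambda>x. x)"
  unfolding ptime_def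
  by (rule exI[of _ "[:1, 1:]"]) (auto intro!: exI computes_Assign[of "EVar _"])

lemma ptime_left: "ptime left"
  unfolding ptime_def
proof (rule exI[of _ "[:1, 2:]"], intro allI exI)
  show "computes b (Assign b (ELeft (EVar b))) left [:1, 2:]" for b
    by (rule computes_Assign) (use nodes_left_le in \<open>auto simp: mult_2\<close>)
qed

lemma ptime_right: "ptime right"
  unfolding ptime_def
proof (rule exI[of _ "[:1, 2:]"], intro allI exI)
  show "computes b (Assign b (ERight (EVar b))) right [:1, 2:]" for b
    by (rule computes_Assign) (use nodes_right_le in \<open>auto simp: mult_2\<close>)
qed

fun const_expr :: "tree \<Rightarrow> expr" where
  "const_expr Leaf = ELeaf"
| "const_expr (Node a b) = ENode (const_expr a) (const_expr b)"

lemma val_const_expr [simp]: "val (const_expr c) s = c"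
  by (induction c) auto

lemma etime_const_expr [simp]: "etime (const_expr c) s = etime (const_expr c) s'"
  by (induction c) auto

lemma ptime_const: "ptime (\<lambda>_. c)"
  unfolding ptime_def
proof (intro exI allI)
  show "computes b (Assign b (const_expr c)) (\<lambda>_. c) [:Suc (etime (const_expr c) (\<lambda>_. Leaf)):]" for b
    by (rule computes_Assign) (auto intro: eq_refl etime_const_expr)
qed

definition of_bool_tree :: "bool \<Rightarrow> tree" where
  "of_bool_tree P = (if P then Node Leaf Leaf else Leaf)"

lemma of_bool_tree_eq_Leaf [simp]: "of_bool_tree P = Leaf \<longleftrightarrow> \<not> P"
  by (simp add: of_bool_tree_def)

lemma ptime_eq_pair: "ptime (\<lambda>x. of_bool_tree (left x = right x))"
  unfolding ptime_def
proof (rule exI[of _ "[:4, 4:]"], intro allI exI)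
  show "computes b (Assign b (EEq (ELeft (EVar b)) (ERight (EVar b))))
    (\<lambda>x. of_bool_tree (left x = right x)) [:4, 4:]" for b
  proof (rule computes_Assign)
    fix s :: state
    show "Suc (etime (EEq (ELeft (EVar b)) (ERight (EVar b))) s) \<le> poly [:4, 4:] (nodes (s b))"
      using nodes_left_le[of "s b"] nodes_right_le[of "s b"] by auto
  qed (auto simp: of_bool_tree_def)
qed

lemma ptime_Node:
  assumes "ptime f" "ptime g"
  shows "ptime (\<lambda>x. Node (f x) (g x))"
proof -
  obtain q q' where q: "\<And>b. \<exists>p. computes b p f q" and q': "\<And>b. \<exists>p. computes b p g q'"
    using assms unfolding ptime_def by blast
  show ?thesis
    unfolding ptime_def
  proof (rule exI[of _ "[:4, 6:] + smult 3 q + smult 3 q'"], rule allI)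
    fix b
    obtain p p' where p: "computes (b + 1) p f q" and p': "computes (b + 2) p' g q'"
      using q q' by meson
    \<comment> \<open>The second call runs at \<open>b + 2\<close>, so that the input in
      \<open>b\<close> and the first result in \<open>b + 1\<close> survive it.\<close>
    let ?P = "Seq (Assign (b+1) (EVar b)) (Seq p (Seq (Assign (b+2) (EVar b))
        (Seq p' (Assign b (ENode (EVar (b+1)) (EVar (b+2)))))))"
    have "computes b ?P (\<lambda>x. Node (f x) (g x)) ([:4, 6:] + smult 3 q + smult 3 q')"
      unfolding computes_def
    proof
      fix s :: state
      let ?s1 = "s(b+1 := s b)"
      have 1: "exec (Assign (b+1) (EVar b)) s (1 + nodes (s b)) ?s1"
        using exec.Assign[of "b+1" "EVar b" s] by simp
      obtain t s2 where 2: "exec p ?s1 t s2" "t \<le> poly q (nodes (s b))" "s2 (b+1) = f (s b)"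
        "\<And>i. i < b + 1 \<Longrightarrow> s2 i = ?s1 i"
        using computesE[OF p, of ?s1] by (metis fun_upd_same)
      have s2b: "s2 b = s b" using 2(4)[of b] by simp
      let ?s3 = "s2(b+2 := s b)"
      have 3: "exec (Assign (b+2) (EVar b)) s2 (1 + nodes (s b)) ?s3"
        using exec.Assign[of "b+2" "EVar b" s2] by (simp add: s2b)
      obtain t' s4 where 4: "exec p' ?s3 t' s4" "t' \<le> poly q' (nodes (s b))" "s4 (b+2) = g (s b)"
        "\<And>i. i < b + 2 \<Longrightarrow> s4 i = ?s3 i"
        using computesE[OF p', of ?s3] by (metis fun_upd_same)
      have s4: "s4 (b+1) = f (s b)" using 4(4)[of "b+1"] 2(3) by simp
      let ?s5 = "s4(b := Node (f (s b)) (g (s b)))"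
      have 5: "exec (Assign b (ENode (EVar (b+1)) (EVar (b+2)))) s4
          (2 + 2 * nodes (f (s b)) + 2 * nodes (g (s b))) ?s5"
        using exec.Assign[of b "ENode (EVar (b+1)) (EVar (b+2))" s4] s4 4(3)
        by (simp add: algebra_simps flip: mult_2)
      have n: "nodes (f (s b)) \<le> nodes (s b) + poly q (nodes (s b))"
        "nodes (g (s b)) \<le> nodes (s b) + poly q' (nodes (s b))"
        using p p' computes_nodes_le by blast+
      have "\<forall>i<b. ?s5 i = s i" using 4(4) 2(4) by simp
      moreover have "1 + nodes (s b) + (t + (1 + nodes (s b) + (t' + 
          (2 + 2 * nodes (f (s b)) + 2 * nodes (g (s b))))))
          \<le> poly ([:4, 6:] + smult 3 q + smult 3 q') (nodes (s b))"
        using n 2(2) 4(2) by simp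
      ultimately show "\<exists>t s'. exec ?P s t s' \<and>
          t \<le> poly ([:4, 6:] + smult 3 q + smult 3 q') (nodes (s b)) \<and>
          s' b = Node (f (s b)) (g (s b)) \<and> (\<forall>i<b. s' i = s i)"
        using 1 2(1) 3 4(1) 5 by (blast intro: exec.Seq fun_upd_same)
    qed
    then show "\<exists>p. computes b p (\<lambda>x. Node (f x) (g x)) ([:4, 6:] + smult 3 q + smult 3 q')" by blast
  qed
qed

lemma ptime_If:
  assumes "ptime c" "ptime f" "ptime g"
  shows "ptime (\<lambda>x. if c x \<noteq> Leaf then f x else g x)"
proof -
  obtain q0 q q' where q0: "\<And>b. \<exists>p. computes b p c q0"
    and q: "\<And>b. \<exists>p. computes b p f q" and q': "\<And>b. \<exists>p. computes b p g q'"
    using assms unfolding ptime_def by blast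
  show ?thesis
    unfolding ptime_def
  proof (rule exI[of _ "[:2, 2:] + smult 2 q0 + q + q'"], rule allI)
    fix b
    obtain p0 p p' where p0: "computes (b + 1) p0 c q0" and p: "computes b p f q"
      and p': "computes b p' g q'"
      using q0 q q' by meson
    let ?P = "Seq (Assign (b+1) (EVar b)) (Seq p0 (If (EVar (b+1)) p p'))"
    let ?q = "[:2, 2:] + smult 2 q0 + q + q'"
    have "computes b ?P (\<lambda>x. if c x \<noteq> Leaf then f x else g x) ?q"
      unfolding computes_def
    proof
      fix s :: state
      let ?s1 = "s(b+1 := s b)"
      have 1: "exec (Assign (b+1) (EVar b)) s (1 + nodes (s b)) ?s1"
        using exec.Assign[of "b+1" "EVar b" s] by simp
      obtain t s2 where 2: "exec p0 ?s1 t s2" "t \<le> poly q0 (nodes (s b))" "s2 (b+1) = c (s b)"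
        "\<And>i. i < b + 1 \<Longrightarrow> s2 i = ?s1 i"
        using computesE[OF p0, of ?s1] by (metis fun_upd_same)
      have s2: "\<And>i. i \<le> b \<Longrightarrow> s2 i = s i" using 2(4) by simp
      have n: "nodes (c (s b)) \<le> nodes (s b) + poly q0 (nodes (s b))"
        using p0 computes_nodes_le by blast
      show "\<exists>t s'. exec ?P s t s' \<and> t \<le> poly ?q (nodes (s b)) \<and>
          s' b = (if c (s b) \<noteq> Leaf then f (s b) else g (s b)) \<and> (\<forall>i<b. s' i = s i)"
      proof (cases "c (s b) = Leaf")
        case True
        obtain t' s3 where 3: "exec p' s2 t' s3" "t' \<le> poly q' (nodes (s b))" "s3 b = g (s b)"
          "\<And>i. i < b \<Longrightarrow> s3 i = s2 i"
          using computesE[OF p', of s2] s2 by (metis order_refl)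
        have 4: "exec (If (EVar (b+1)) p p') s2 (1 + nodes (c (s b)) + t') s3"
          using exec.IfFalse[of "EVar (b+1)" s2 p' t' s3] 2(3) True 3 by simp
        have "1 + nodes (s b) + (t + (1 + nodes (c (s b)) + t')) \<le> poly ?q (nodes (s b))"
          using n 2(2) 3(2) by simp
        moreover have "exec ?P s (1 + nodes (s b) + (t + (1 + nodes (c (s b)) + t'))) s3"
          using 1 2 4 by (blast intro: exec.Seq)
        moreover have "\<forall>i<b. s3 i = s i" using 3(4) s2 by simp
        ultimately show ?thesis using True 3(3) by metis
      next
        case False
        obtain t' s3 where 3: "exec p s2 t' s3" "t' \<le> poly q (nodes (s b))" "s3 b = f (s b)"
          "\<And>i. i < b \<Longrightarrow> s3 i = s2 i"
          using computesE[OF p, of s2] s2 by (metis order_refl)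
        have 4: "exec (If (EVar (b+1)) p p') s2 (1 + nodes (c (s b)) + t') s3"
          using exec.IfTrue[of "EVar (b+1)" s2 p t' s3] 2(3) False 3 by simp
        have "1 + nodes (s b) + (t + (1 + nodes (c (s b)) + t')) \<le> poly ?q (nodes (s b))"
          using n 2(2) 3(2) by simp
        moreover have "exec ?P s (1 + nodes (s b) + (t + (1 + nodes (c (s b)) + t'))) s3"
          using 1 2 4 by (blast intro: exec.Seq)
        moreover have "\<forall>i<b. s3 i = s i" using 3(4) s2 by simp
        ultimately show ?thesis using False 3(3) by metis
      qed
    qed
    then show "\<exists>p. computes b p (\<lambda>x. if c x \<noteq> Leaf then f x else g x) ?q" by blast
  qed
qed

text \<open>The right spine of a tree is read as a list. Folds are the only loops in the algorithms,
  so every loop is bounded by the size of a tree.\<close>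

fun tfold :: "(tree \<Rightarrow> tree \<Rightarrow> tree) \<Rightarrow> tree \<Rightarrow> tree \<Rightarrow> tree" where
  "tfold h Leaf s = s"
| "tfold h (Node a l) s = tfold h l (h a s)"

lemma nodes_tfold_le:
  assumes "\<And>a s. nodes a \<le> nodes l \<Longrightarrow> nodes (h a s) \<le> nodes s + g"
  shows "nodes (tfold h l s) \<le> nodes s + nodes l * g"
  using assms
proof (induction l arbitrary: s)
  case (Node a l)
  have "nodes (tfold h l (h a s)) \<le> nodes (h a s) + nodes l * g"
    using Node.prems by (intro Node.IH) simp
  also have "nodes (h a s) \<le> nodes s + g" using Node.prems[of a] by simp
  finally show ?case by (simp add: algebra_simps)
qed simp

text \<open>Register \<open>b + 1\<close> holds the parameter, \<open>b + 2\<close> the rest of the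
  list, \<open>b + 3\<close> the accumulator, and \<open>b + 4\<close> the argument and then the
  result of \<open>p\<close>. The bound by \<open>M\<close> is an invariant: an iteration adds at
  most \<open>g\<close> to the accumulator and removes at least one node from the list. So the
  arguments of \<open>p\<close> never exceed \<open>D\<close>, where the 2 counts their two outer
  constructors.\<close>

lemma exec_fold_loop:
  fixes b :: nat
  assumes p: "computes (b + 4) p (\<lambda>y. h (left y) (left (right y)) (right (right y))) q"
  assumes g: "\<And>a z. nodes a \<le> N \<Longrightarrow> nodes (h x a z) \<le> nodes z + g"
  assumes D: "D = nodes x + N + M + 2"
  defines "loop \<equiv> While (EVar (b+2)) (Seq (Assign (b+4) (ENode (EVar (b+1))
      (ENode (ELeft (EVar (b+2))) (EVar (b+3))))) (Seq p (Seq (Assign (b+3) (EVar (b+4)))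
      (Assign (b+2) (ERight (EVar (b+2)))))))"
  assumes "s (b+1) = x" "s (b+2) = l" "s (b+3) = z"
    and "nodes l \<le> N" "nodes z + nodes l * g \<le> M"
  shows "\<exists>t s'. exec loop s t s' \<and> t \<le> nodes l * (poly q D + 20 * D) \<and>
    s' (b+3) = tfold (h x) l z \<and> (\<forall>i\<le>b. s' i = s i)"
  using assms(5-)
proof (induction l arbitrary: s z)
  case Leaf
  have "exec loop s 2 s"
    using exec.WhileFalse[of "EVar (b+2)" s] Leaf.prems unfolding loop_def by (simp add: numeral_2_eq_2)
  moreover have "2 \<le> D" using D by simp
  ultimately show ?case using Leaf.prems by (intro exI[of _ 2] exI[of _ s]) auto
next
  case (Node a l)
  let ?y = "Node x (Node a z)"
  let ?s1 = "s(b+4 := ?y)"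
  define t1 where "t1 = 1 + etime (ENode (EVar (b+1)) (ENode (ELeft (EVar (b+2))) (EVar (b+3)))) s"
  have 1: "exec (Assign (b+4) (ENode (EVar (b+1)) (ENode (ELeft (EVar (b+2))) (EVar (b+3))))) s t1 ?s1"
    using exec.Assign[of "b+4" "ENode (EVar (b+1)) (ENode (ELeft (EVar (b+2))) (EVar (b+3)))" s] Node.prems
    unfolding t1_def by simp
  have Na: "nodes a \<le> N" using Node.prems by simp
  have Nl: "nodes l \<le> N" using Node.prems by simp
  have Mz: "nodes z + g + nodes l * g \<le> M" using Node.prems by (simp add: algebra_simps)
  have t1: "t1 \<le> 10 * D" using Node.prems unfolding t1_def D by simp
  have yD: "nodes ?y \<le> D" using Na Mz D by simp
  obtain t s2 where 2: "exec p ?s1 t s2" "t \<le> poly q (nodes ?y)" "s2 (b+4) = h x a z"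
    "\<And>i. i < b + 4 \<Longrightarrow> s2 i = ?s1 i"
    using computesE[OF p, of ?s1] by (metis fun_upd_same left.simps(2) right.simps(2))
  have tD: "t \<le> poly q D" using 2(2) poly_nat_mono[OF yD, of q] by simp
  let ?s3 = "s2(b+3 := h x a z)"
  have 3: "exec (Assign (b+3) (EVar (b+4))) s2 (1 + nodes (h x a z)) ?s3"
    using exec.Assign[of "b+3" "EVar (b+4)" s2] by (simp add: 2(3))
  have nz: "nodes (h x a z) \<le> nodes z + g" using g[OF Na] .
  have s3: "?s3 (b+2) = Node a l" using 2(4)[of "b+2"] Node.prems by simp
  let ?s4 = "?s3(b+2 := l)"
  define t4 where "t4 = 1 + etime (ERight (EVar (b+2))) ?s3"
  have 4: "exec (Assign (b+2) (ERight (EVar (b+2)))) ?s3 t4 ?s4"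
    using exec.Assign[of "b+2" "ERight (EVar (b+2))" ?s3] s3 unfolding t4_def by simp
  have t4: "t4 \<le> 2 * D" using s3 Node.prems unfolding t4_def D by simp
  have "\<exists>t s'. exec loop ?s4 t s' \<and> t \<le> nodes l * (poly q D + 20 * D) \<and>
    s' (b+3) = tfold (h x) l (h x a z) \<and> (\<forall>i\<le>b. s' i = ?s4 i)"
  proof (rule Node.IH)
    show "?s4 (b+1) = x" using 2(4)[of "b+1"] Node.prems by simp
    show "nodes (h x a z) + nodes l * g \<le> M" using nz Mz by simp
  qed (use Nl in auto)
  then obtain t5 s5 where 5: "exec loop ?s4 t5 s5" "t5 \<le> nodes l * (poly q D + 20 * D)"
    "s5 (b+3) = tfold (h x) l (h x a z)" "\<forall>i\<le>b. s5 i = ?s4 i" by blast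
  let ?t = "1 + nodes (Node a l) + (t1 + (t + (1 + nodes (h x a z) + t4))) + t5"
  have "exec loop s ?t s5"
    unfolding loop_def
    using exec.WhileTrue[OF _ exec.Seq[OF 1 exec.Seq[OF 2(1) exec.Seq[OF 3 4]]] 5(1)[unfolded loop_def]]
      Node.prems(2) by simp
  moreover have "?t \<le> nodes (Node a l) * (poly q D + 20 * D)"
  proof -
    have "1 + nodes (Node a l) \<le> D" "1 + nodes (h x a z) \<le> D"
      using nz Mz Node.prems D by auto
    then have "?t \<le> (poly q D + 20 * D) + nodes l * (poly q D + 20 * D)"
      using t1 tD t4 5(2) by linarith
    then show ?thesis by (simp add: algebra_simps)
  qed
  moreover have "\<forall>i\<le>b. s5 i = s i" using 5(4) 2(4) by simp
  ultimately show ?case using 5(3) by (metis tfold.simps(2))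
qed

text \<open>The growth condition must not involve the size of \<open>z\<close>: a step that doubles
  the accumulator takes polynomial time as well, yet its iteration produces exponentially large
  trees.\<close>

lemma ptime_tfold_triple:
  assumes "ptime (\<lambda>y. h (left y) (left (right y)) (right (right y)))"
  assumes g: "\<And>x a z. nodes (h x a z) \<le> nodes z + poly g (nodes x + nodes a)"
  shows "ptime (\<lambda>y. tfold (h (left y)) (left (right y)) (right (right y)))"
proof -
  obtain q where q: "\<And>b. \<exists>p. computes b p (\<lambda>y. h (left y) (left (right y)) (right (right y))) q"
    using assms unfolding ptime_def by blast
  \<comment> \<open>The parameter and each list element have at most \<open>n\<close> nodes, hence
    the argument \<open>2 * n\<close> for \<open>g\<close>. The polynomial \<open>d\<close> bounds
    the \<open>D\<close> of the loop, and \<open>Q\<close> the whole running time.\<close>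
  define g2 where "g2 = pcompose g [:0, 2:]"
  define d where "d = [:2, 3:] + [:0, 1:] * g2"
  define Q where "Q = [:20, 20:] + [:0, 1:] * (pcompose q d + smult 20 d) + d"
  show ?thesis
    unfolding ptime_def
  proof (rule exI[of _ Q], rule allI)
    fix b
    obtain p where p: "computes (b + 4) p (\<lambda>y. h (left y) (left (right y)) (right (right y))) q"
      using q by blast
    let ?loop = "While (EVar (b+2)) (Seq (Assign (b+4) (ENode (EVar (b+1))
      (ENode (ELeft (EVar (b+2))) (EVar (b+3))))) (Seq p (Seq (Assign (b+3) (EVar (b+4)))
      (Assign (b+2) (ERight (EVar (b+2)))))))"
    let ?P = "Seq (Assign (b+1) (ELeft (EVar b))) (Seq (Assign (b+2) (ELeft (ERight (EVar b))))
      (Seq (Assign (b+3) (ERight (ERight (EVar b)))) (Seq ?loop (Assign b (EVar (b+3))))))"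
    have "computes b ?P (\<lambda>y. tfold (h (left y)) (left (right y)) (right (right y))) Q"
      unfolding computes_def
    proof
      fix s :: state
      define y where "y = s b"
      define x where "x = left y"
      define l where "l = left (right y)"
      define z where "z = right (right y)"
      define n where "n = nodes y"
      have nx: "nodes x \<le> n" "nodes l \<le> n" "nodes z \<le> n" "nodes (right y) \<le> n"
        unfolding x_def l_def z_def n_def
        using nodes_left_le nodes_right_le order_trans by blast+
      define gg where "gg = poly g2 n"
      have G: "nodes (h x a z') \<le> nodes z' + gg" if "nodes a \<le> n" for a z'
      proof -
        have "poly g (nodes x + nodes a) \<le> poly g (n + n)"
          using that nx by (intro poly_nat_mono) simp
        also have "\<dots> = gg" unfolding gg_def g2_def by (simp add: poly_pcompose mult_2_right)
        finally show ?thesis using g[of x a z'] by linarith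
      qed
      define M where "M = n + n * gg"
      define D where "D = nodes x + n + M + 2"
      have DQ: "D \<le> poly d n" unfolding D_def M_def d_def gg_def using nx by (simp add: algebra_simps)
      let ?s1 = "s(b+1 := x)"
      let ?s2 = "?s1(b+2 := l)"
      let ?s3 = "?s2(b+3 := z)"
      have 1: "exec (Assign (b+1) (ELeft (EVar b))) s (1 + n + nodes x) ?s1"
        using exec.Assign[of "b+1" "ELeft (EVar b)" s] by (simp add: y_def x_def n_def)
      have 2: "exec (Assign (b+2) (ELeft (ERight (EVar b)))) ?s1 (1 + n + nodes (right y) + nodes l) ?s2"
        using exec.Assign[of "b+2" "ELeft (ERight (EVar b))" ?s1] by (simp add: y_def l_def n_def)
      have 3: "exec (Assign (b+3) (ERight (ERight (EVar b)))) ?s2 (1 + n + nodes (right y) + nodes z) ?s3"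
        using exec.Assign[of "b+3" "ERight (ERight (EVar b))" ?s2] by (simp add: y_def z_def n_def)
      have "\<exists>t s'. exec ?loop ?s3 t s' \<and> t \<le> nodes l * (poly q D + 20 * D) \<and>
          s' (b+3) = tfold (h x) l z \<and> (\<forall>i\<le>b. s' i = ?s3 i)"
      proof (rule exec_fold_loop[OF p G D_def])
        show "nodes z + nodes l * gg \<le> M" unfolding M_def using nx by (intro add_mono mult_mono) auto
      qed (use nx in auto)
      then obtain t s4 where 4: "exec ?loop ?s3 t s4" "t \<le> nodes l * (poly q D + 20 * D)"
          "s4 (b+3) = tfold (h x) l z" "\<forall>i\<le>b. s4 i = ?s3 i" by blast
      let ?s5 = "s4(b := tfold (h x) l z)"
      have 5: "exec (Assign b (EVar (b+3))) s4 (1 + nodes (tfold (h x) l z)) ?s5"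
        using exec.Assign[of b "EVar (b+3)" s4] by (simp add: 4(3))
      let ?t = "1 + n + nodes x + (1 + n + nodes (right y) + nodes l + (1 + n + nodes (right y) + nodes z +
        (t + (1 + nodes (tfold (h x) l z)))))"
      have E: "exec ?P s ?t ?s5"
        by (rule exec.Seq[OF 1 exec.Seq[OF 2 exec.Seq[OF 3 exec.Seq[OF 4(1) 5]]]])
      have "nodes (tfold (h x) l z) \<le> nodes z + nodes l * gg"
        using nx(2) by (intro nodes_tfold_le G) simp
      also have "\<dots> \<le> M" unfolding M_def using nx by (intro add_mono mult_mono) auto
      also have "\<dots> \<le> D" unfolding D_def by simp
      finally have 6: "nodes (tfold (h x) l z) \<le> poly d n" using DQ by simp
      have "t \<le> n * (poly q D + 20 * D)"
        using 4(2) nx(2) mult_le_mono1 order_trans by blast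
      also have "\<dots> \<le> n * (poly q (poly d n) + 20 * poly d n)"
        using DQ by (intro mult_le_mono2 add_mono poly_nat_mono) auto
      finally have "?t \<le> poly Q n"
        unfolding Q_def using 6 nx by (simp add: poly_pcompose algebra_simps)
      moreover have "\<forall>i<b. ?s5 i = s i" using 4(4) by simp
      ultimately show "\<exists>t s'. exec ?P s t s' \<and> t \<le> poly Q (nodes (s b)) \<and>
        s' b = tfold (h (left (s b))) (left (right (s b))) (right (right (s b))) \<and> (\<forall>i<b. s' i = s i)"
        using E unfolding n_def x_def l_def z_def y_def by (metis fun_upd_same)
    qed
    then show "\<exists>p. computes b p (\<lambda>y. tfold (h (left y)) (left (right y)) (right (right y))) Q" by blast
  qed
qed

lemma ptime_left': "ptime f \<Longrightarrow> ptime (\<lambda>x. left (f x))"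
  by (rule ptime_comp[OF ptime_left])

lemma ptime_right': "ptime f \<Longrightarrow> ptime (\<lambda>x. right (f x))"
  by (rule ptime_comp[OF ptime_right])

lemma ptime_eq:
  assumes "ptime f" "ptime g"
  shows "ptime (\<lambda>x. of_bool_tree (f x = g x))"
  using ptime_comp[OF ptime_eq_pair ptime_Node[OF assms]] by simp

lemma ptime_tfold:
  assumes "ptime (\<lambda>y. h (left y) (left (right y)) (right (right y)))"
    and "\<And>x a z. nodes (h x a z) \<le> nodes z + poly g (nodes x + nodes a)"
    and "ptime c" "ptime l" "ptime z"
  shows "ptime (\<lambda>x. tfold (h (c x)) (l x) (z x))"
  using ptime_comp[OF ptime_tfold_triple[OF assms(1,2)] ptime_Node[OF assms(3) ptime_Node[OF assms(4,5)]]]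
  by simp

lemmas ptime_intros = ptime_id ptime_const ptime_left' ptime_right' ptime_Node ptime_eq

section \<open>Local search on trees\<close>

fun elements :: "tree \<Rightarrow> tree list" where
  "elements Leaf = []"
| "elements (Node a l) = a # elements l"

lemma elements_code_list [simp]: "elements (code_list c xs) = map c xs"
  by (induction xs) auto

text \<open>Here and below, conditions are spelled as \<open>\<noteq> Leaf\<close> to match
  \<open>ptime_If\<close>.\<close>

definition t_mem :: "tree \<Rightarrow> tree \<Rightarrow> tree" where
  "t_mem v X = tfold (\<lambda>a z. if of_bool_tree (a = v) \<noteq> Leaf then Node Leaf Leaf else z) X Leaf"

lemma t_mem_eq: "t_mem v X = of_bool_tree (v \<in> set (elements X))"
proof -
  have "tfold (\<lambda>a z. if of_bool_tree (a = v) \<noteq> Leaf then Node Leaf Leaf else z) X (of_bool_tree P)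
      = of_bool_tree (P \<or> v \<in> set (elements X))" for P
  proof (induction X arbitrary: P)
    case (Node a X)
    from Node.IH(2)[of P] Node.IH(2)[of True] show ?case
      by (auto simp: of_bool_tree_def[of True])
  qed simp
  from this[of False] show ?thesis by (simp add: t_mem_def of_bool_tree_def[of False])
qed

lemma ptime_mem:
  assumes "ptime f" "ptime g"
  shows "ptime (\<lambda>x. t_mem (f x) (g x))"
  unfolding t_mem_def
  by (rule ptime_tfold[where g = "[:3:]" and
        h = "\<lambda>v a z. if of_bool_tree (a = v) \<noteq> Leaf then Node Leaf Leaf else z"])
    (intro ptime_If ptime_intros assms | simp)+

text \<open>The symmetric difference of \<open>X\<close> and \<open>l\<close> within
  \<open>vs\<close>. It is rebuilt from \<open>vs\<close>, from which it inherits distinctness and a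
  size bound, whatever \<open>X\<close> and \<open>l\<close> are.\<close>

definition t_flip :: "tree \<Rightarrow> tree \<Rightarrow> tree \<Rightarrow> tree" where
  "t_flip vs X l = tfold (\<lambda>v z. if of_bool_tree (t_mem v X = t_mem v l) \<noteq> Leaf then z else Node v z) vs Leaf"

lemma elements_t_flip:
  "elements (t_flip vs X l) =
    rev (filter (\<lambda>v. (v \<in> set (elements X)) \<noteq> (v \<in> set (elements l))) (elements vs))"
proof -
  have "elements (tfold (\<lambda>v z. if of_bool_tree (t_mem v X = t_mem v l) \<noteq> Leaf then z else Node v z) vs z)
      = rev (filter (\<lambda>v. (v \<in> set (elements X)) \<noteq> (v \<in> set (elements l))) (elements vs)) @ elements z" for z
    by (induction vs arbitrary: z) (auto simp: t_mem_eq of_bool_tree_def)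
  from this[of Leaf] show ?thesis by (simp add: t_flip_def)
qed

lemma nodes_t_flip_le: "nodes (t_flip vs X l) \<le> nodes vs"
proof -
  have "nodes (tfold (\<lambda>v z. if of_bool_tree (t_mem v X = t_mem v l) \<noteq> Leaf then z else Node v z) vs z) + 1
      \<le> nodes z + nodes vs" for z
  proof (induction vs arbitrary: z)
    case (Node v vs)
    from Node.IH(2)[of z] Node.IH(2)[of "Node v z"] show ?case by auto
  qed simp
  from this[of Leaf] show ?thesis by (simp add: t_flip_def)
qed

lemma ptime_flip:
  assumes "ptime f" "ptime g" "ptime k"
  shows "ptime (\<lambda>x. t_flip (f x) (g x) (k x))"
proof -
  have "ptime (\<lambda>x. tfold ((\<lambda>y v z. if of_bool_tree (t_mem v (left y) = t_mem v (right y)) \<noteq> Leaf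
      then z else Node v z) (Node (g x) (k x))) (f x) Leaf)"
    by (rule ptime_tfold[where g = "[:1, 1:]"]) (intro ptime_If ptime_intros ptime_mem assms | simp)+
  then show ?thesis by (simp add: t_flip_def)
qed

definition t_covers :: "tree \<Rightarrow> tree \<Rightarrow> tree" where
  "t_covers es X = tfold (\<lambda>e z. if t_mem (left e) X \<noteq> Leaf then z
      else if t_mem (right e) X \<noteq> Leaf then z else Leaf) es (Node Leaf Leaf)"

definition tree_cover :: "tree \<Rightarrow> tree \<Rightarrow> bool" where
  "tree_cover es X \<longleftrightarrow>
    (\<forall>e \<in> set (elements es). left e \<in> set (elements X) \<or> right e \<in> set (elements X))"

lemma t_covers_eq_Leaf [simp]: "t_covers es X = Leaf \<longleftrightarrow> \<not> tree_cover es X"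
proof -
  have "tfold (\<lambda>e z. if t_mem (left e) X \<noteq> Leaf then z
      else if t_mem (right e) X \<noteq> Leaf then z else Leaf) es z = (if tree_cover es X then z else Leaf)" for z
    by (induction es arbitrary: z) (auto simp: tree_cover_def t_mem_eq)
  then show ?thesis by (simp add: t_covers_def)
qed

lemma ptime_covers:
  assumes "ptime f" "ptime g"
  shows "ptime (\<lambda>x. t_covers (f x) (g x))"
  unfolding t_covers_def
  by (rule ptime_tfold[where g = "[:1:]" and h = "\<lambda>X e z. if t_mem (left e) X \<noteq> Leaf then z
      else if t_mem (right e) X \<noteq> Leaf then z else Leaf"])
    (intro ptime_If ptime_intros ptime_mem assms | simp)+

text \<open>Compares lengths without arithmetic: one element of \<open>Y\<close> is removed per
  element of \<open>X\<close>, and something remains iff \<open>Y\<close> is longer.\<close>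

definition t_drop :: "tree \<Rightarrow> tree \<Rightarrow> tree" where
  "t_drop X Y = tfold (\<lambda>_ z. right z) X Y"

lemma t_drop_eq_Leaf [simp]:
  "t_drop X Y = Leaf \<longleftrightarrow> length (elements Y) \<le> length (elements X)"
proof -
  have "elements (t_drop X Y) = drop (length (elements X)) (elements Y)"
    unfolding t_drop_def
  proof (induction X arbitrary: Y)
    case (Node a X)
    then show ?case by (cases Y) auto
  qed simp
  then show ?thesis by (cases "t_drop X Y") auto
qed

lemma ptime_drop:
  assumes "ptime f" "ptime g"
  shows "ptime (\<lambda>x. t_drop (f x) (g x))"
  unfolding t_drop_def
  by (rule ptime_tfold[where g = 0 and h = "\<lambda>_ _ z. right z" and c = "\<lambda>_. Leaf"])
    (intro ptime_If ptime_intros ptime_mem assms | simp add: nodes_right_le)+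

definition t_improve :: "tree \<Rightarrow> tree \<Rightarrow> tree \<Rightarrow> tree" where
  "t_improve G l X =
    (if t_covers (right G) (t_flip (left G) X l) \<noteq> Leaf
     then if t_drop (t_flip (left G) X l) X \<noteq> Leaf then t_flip (left G) X l else X
     else X)"

lemma ptime_improve:
  assumes "ptime f" "ptime g" "ptime k"
  shows "ptime (\<lambda>x. t_improve (f x) (g x) (k x))"
  unfolding t_improve_def
  by (intro ptime_If ptime_intros ptime_covers ptime_drop ptime_flip assms)

text \<open>The bound is a maximum and not a sum, so it does not deteriorate under repetition and
  carries over to whole passes.\<close>

lemma nodes_t_improve_le: "nodes (t_improve G l X) \<le> max (nodes X) (nodes G)"
  using nodes_t_flip_le[of "left G" X l] nodes_left_le[of G] by (auto simp: t_improve_def)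

definition t_pass :: "tree \<Rightarrow> tree \<Rightarrow> tree \<Rightarrow> tree" where
  "t_pass G L X = tfold (t_improve G) L X"

lemma nodes_t_pass_le: "nodes (t_pass G L X) \<le> max (nodes X) (nodes G)"
  unfolding t_pass_def
proof (induction L arbitrary: X)
  case (Node l L)
  from Node.IH(2)[of "t_improve G l X"] nodes_t_improve_le[of G l X] show ?case by auto
qed simp

lemma ptime_pass:
  assumes "ptime f" "ptime g" "ptime k"
  shows "ptime (\<lambda>x. t_pass (f x) (g x) (k x))"
  unfolding t_pass_def
proof (rule ptime_tfold[where g = "[:0, 1:]"])
  fix G l X
  show "nodes (t_improve G l X) \<le> nodes X + poly [:0, 1:] (nodes G + nodes l)"
    using nodes_t_improve_le[of G l X] by auto
qed (intro ptime_improve ptime_intros assms)+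

text \<open>The vertex list \<open>left (left x)\<close> is both the initial cover and the counter:
  a pass that changes the cover shortens it, so one pass per vertex suffices to reach a fixed
  point.\<close>

definition t_search :: "tree \<Rightarrow> tree" where
  "t_search x = tfold (\<lambda>_ X. t_pass (left x) (right x) X) (left (left x)) (left (left x))"

lemma ptime_search: "ptime t_search"
proof -
  have "ptime (\<lambda>x. tfold ((\<lambda>x _ X. t_pass (left x) (right x) X) x) (left (left x)) (left (left x)))"
  proof (rule ptime_tfold[where g = "[:0, 1:]"])
    fix x a z
    show "nodes (t_pass (left x) (right x) z) \<le> nodes z + poly [:0, 1:] (nodes x + nodes a)"
      using nodes_t_pass_le[of "left x" "right x" z] nodes_left_le[of x] by auto
  qed (intro ptime_pass ptime_intros)+
  then show ?thesis by (simp add: t_search_def[abs_def])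
qed

section \<open>Enumeration of all small vertex sets\<close>

definition t_append :: "tree \<Rightarrow> tree \<Rightarrow> tree" where
  "t_append X Y = tfold Node X Y"

lemma elements_t_append: "elements (t_append X Y) = rev (elements X) @ elements Y"
  unfolding t_append_def by (induction X arbitrary: Y) auto

lemma nodes_t_append: "nodes (t_append X Y) + 1 = nodes X + nodes Y"
  unfolding t_append_def by (induction X arbitrary: Y) auto

lemma ptime_append:
  assumes "ptime f" "ptime g"
  shows "ptime (\<lambda>x. t_append (f x) (g x))"
  unfolding t_append_def
  by (rule ptime_tfold[where g = "[:1, 1:]" and h = "\<lambda>_. Node" and c = "\<lambda>_. Leaf"])
    (intro ptime_intros assms | simp)+

definition t_products :: "tree \<Rightarrow> tree \<Rightarrow> tree \<Rightarrow> tree" where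
  "t_products a L z = tfold (\<lambda>b z. Node (t_append a b) z) L z"

lemma elements_t_products:
  "elements (t_products a L z) = rev (map (t_append a) (elements L)) @ elements z"
  unfolding t_products_def by (induction L arbitrary: z) auto

lemma nodes_t_products_le:
  "nodes (t_products a L z) \<le> nodes z + nodes L * (1 + nodes a + nodes L)"
  unfolding t_products_def
proof (rule nodes_tfold_le)
  fix b z
  assume "nodes b \<le> nodes L"
  then show "nodes (Node (t_append a b) z) \<le> nodes z + (1 + nodes a + nodes L)"
    using nodes_t_append[of a b] by simp
qed

lemma ptime_products:
  assumes "ptime f" "ptime g" "ptime k"
  shows "ptime (\<lambda>x. t_products (f x) (g x) (k x))"
  unfolding t_products_def
proof (rule ptime_tfold[where g = "[:1, 1:]" and h = "\<lambda>a b z. Node (t_append a b) z"])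
  fix a b z
  show "nodes (Node (t_append a b) z) \<le> nodes z + poly [:1, 1:] (nodes a + nodes b)"
    using nodes_t_append[of a b] by simp
qed (intro ptime_intros ptime_append assms)+

text \<open>The graph is carried along on the left. Starting from one-element lists,
  \<open>m\<close> rounds yield the lists of \<open>2 ^ m\<close> vertices, repetitions included.
  Their number is polynomial for fixed \<open>m\<close>, and all rounds run the same
  program.\<close>

definition t_square :: "tree \<Rightarrow> tree" where
  "t_square x = Node (left x) (tfold (\<lambda>a z. t_products a (right x) z) (right x) Leaf)"

lemma ptime_square: "ptime t_square"
proof -
  have "ptime (\<lambda>x. tfold ((\<lambda>L a z. t_products a L z) (right x)) (right x) Leaf)"
  proof (rule ptime_tfold[where g = "[:0, 1, 1:]"])
    fix L a z
    have "nodes L * (1 + nodes a + nodes L) \<le> (nodes L + nodes a) * (1 + (nodes L + nodes a))"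
      by (intro mult_mono) auto
    then show "nodes (t_products a L z) \<le> nodes z + poly [:0, 1, 1:] (nodes L + nodes a)"
      using nodes_t_products_le[of a L z] by (simp add: algebra_simps)
  qed (intro ptime_intros ptime_products)+
  then have "ptime (\<lambda>x. Node (left x) (tfold (\<lambda>a z. t_products a (right x) z) (right x) Leaf))"
    by (intro ptime_intros)
  then show ?thesis by (simp add: t_square_def[abs_def])
qed

lemma elements_right_t_square:
  "set (elements (right (t_square x))) =
    {t_append a b |a b. a \<in> set (elements (right x)) \<and> b \<in> set (elements (right x))}"
proof -
  have "set (elements (tfold (\<lambda>a z. t_products a L z) M z)) =
    {t_append a b |a b. a \<in> set (elements M) \<and> b \<in> set (elements L)} \<union> set (elements z)" for L M z
    by (induction M arbitrary: z) (auto simp: elements_t_products)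
  then show ?thesis by (simp add: t_square_def)
qed

definition t_start :: "tree \<Rightarrow> tree" where
  "t_start G = Node G (tfold (\<lambda>v z. Node (Node v Leaf) z) (left G) Leaf)"

lemma ptime_start: "ptime t_start"
proof -
  have "ptime (\<lambda>x. Node x (tfold ((\<lambda>_ v z. Node (Node v Leaf) z) Leaf) (left x) Leaf))"
    by (intro ptime_intros, rule ptime_tfold[where g = "[:3, 1:]"]) (intro ptime_intros | simp)+
  then show ?thesis by (simp add: t_start_def[abs_def])
qed

lemma elements_right_t_start:
  "set (elements (right (t_start G))) = (\<lambda>v. Node v Leaf) ` set (elements (left G))"
proof -
  have "set (elements (tfold (\<lambda>v z. Node (Node v Leaf) z) l z)) =
      (\<lambda>v. Node v Leaf) ` set (elements l) \<union> set (elements z)" for l z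
    by (induction l arbitrary: z) auto
  then show ?thesis by (simp add: t_start_def)
qed

lemma left_squares [simp]: "left ((t_square ^^ m) (t_start G)) = G"
  by (induction m) (auto simp: t_square_def t_start_def)

text \<open>Since lists may repeat vertices, the two halves of a set may overlap: a set that is
  already small is its own union with itself, and from a larger one \<open>2 ^ m\<close> elements
  are split off. No list is empty, so both halves must be nonempty.\<close>

lemma subset_listed:
  assumes "S \<subseteq> set (elements (left G))" "S \<noteq> {}" "card S \<le> 2 ^ m"
  shows "\<exists>l \<in> set (elements (right ((t_square ^^ m) (t_start G)))). set (elements l) = S"
  using assms
proof (induction m arbitrary: S)
  case 0
  then have "finite S" using finite_subset by blast
  with 0 have "card S = 1" by (metis card_gt_0_iff le_antisym less_eq_Suc_le One_nat_def power_0)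
  then obtain v where "S = {v}" using card_1_singletonE by blast
  with 0 show ?case by (auto simp: elements_right_t_start)
next
  case (Suc m)
  then have fin: "finite S" using finite_subset by blast
  have "\<exists>S1 S2. S = S1 \<union> S2 \<and> S1 \<noteq> {} \<and> S2 \<noteq> {} \<and> card S1 \<le> 2 ^ m \<and> card S2 \<le> 2 ^ m"
  proof (cases "card S \<le> 2 ^ m")
    case True
    with Suc.prems show ?thesis by (intro exI[of _ S]) auto
  next
    case False
    then obtain S1 where S1: "S1 \<subseteq> S" "card S1 = 2 ^ m"
      using obtain_subset_with_card_n[of "2 ^ m" S] by auto
    have "card (S - S1) = card S - 2 ^ m"
      using S1 fin by (metis card_Diff_subset finite_subset)
    moreover have "S1 \<noteq> {}" using S1 by (metis card.empty power_not_zero zero_neq_numeral)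
    moreover have "S - S1 \<noteq> {}" using S1 False by auto
    ultimately show ?thesis using S1 Suc.prems by (intro exI[of _ S1] exI[of _ "S - S1"]) auto
  qed
  then obtain S1 S2 where S: "S = S1 \<union> S2" "S1 \<noteq> {}" "S2 \<noteq> {}" "card S1 \<le> 2 ^ m" "card S2 \<le> 2 ^ m"
    by blast
  obtain l1 l2 where "l1 \<in> set (elements (right ((t_square ^^ m) (t_start G))))" "set (elements l1) = S1"
      "l2 \<in> set (elements (right ((t_square ^^ m) (t_start G))))" "set (elements l2) = S2"
    using Suc.IH[of S1] Suc.IH[of S2] S Suc.prems(1) by blast
  then show ?case
    using S(1) by (intro bexI[of _ "t_append l1 l2"])
      (auto simp: elements_right_t_square elements_t_append)
qed

section \<open>Local optimality of the computed cover\<close>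

lemma funpow_stable:
  fixes \<mu> :: "'a \<Rightarrow> nat"
  assumes "\<And>x. g x = x \<or> \<mu> (g x) < \<mu> x" "\<mu> x \<le> n"
  shows "g ((g ^^ n) x) = (g ^^ n) x"
  using assms(2)
proof (induction n arbitrary: x)
  case 0
  with assms(1)[of x] show ?case by auto
next
  case (Suc n)
  show ?case
  proof (cases "g x = x")
    case True
    then have "(g ^^ k) x = x" for k by (induction k) auto
    with True show ?thesis by metis
  next
    case False
    with assms(1)[of x] Suc.prems have "\<mu> (g x) \<le> n" by simp
    from Suc.IH[OF this] show ?thesis by (simp add: funpow_swap1)
  qed
qed

lemma t_improve_cases:
  "t_improve G l X = X \<or> length (elements (t_improve G l X)) < length (elements X)"
  by (auto simp: t_improve_def)

text \<open>Accepted changes are strict improvements. A pass that does not shorten the cover has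
  therefore changed nothing on its way and has tested every listed set against the same
  cover.\<close>

lemma t_pass_cases:
  "(t_pass G L X = X \<and> (\<forall>l \<in> set (elements L). t_improve G l X = X)) \<or>
    length (elements (t_pass G L X)) < length (elements X)"
proof (induction L arbitrary: X)
  case (Node l L)
  note IH = Node.IH(2)[of "t_improve G l X"]
  show ?case
  proof (cases "t_improve G l X = X")
    case True
    with IH show ?thesis by (auto simp: t_pass_def)
  next
    case False
    with IH t_improve_cases[of G l X] show ?thesis by (auto simp: t_pass_def)
  qed
qed (simp add: t_pass_def)

lemma t_search_eq:
  "t_search x = (t_pass (left x) (right x) ^^ length (elements (left (left x)))) (left (left x))"
proof -
  have "tfold (\<lambda>_. g) l z = (g ^^ length (elements l)) z" for g l z
    by (induction l arbitrary: z) (auto simp: funpow_swap1)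
  then show ?thesis by (simp add: t_search_def)
qed

definition proper_cover :: "tree \<Rightarrow> tree \<Rightarrow> bool" where
  "proper_cover G X \<longleftrightarrow> distinct (elements X) \<and> set (elements X) \<subseteq> set (elements (left G)) \<and>
    tree_cover (right G) X"

lemma proper_cover_t_flip:
  assumes "distinct (elements (left G))" "tree_cover (right G) (t_flip (left G) X l)"
  shows "proper_cover G (t_flip (left G) X l)"
  using assms unfolding proper_cover_def by (auto simp: elements_t_flip)

lemma proper_cover_t_improve:
  assumes "distinct (elements (left G))" "proper_cover G X"
  shows "proper_cover G (t_improve G l X)"
  using assms proper_cover_t_flip[OF assms(1), of X l] unfolding t_improve_def by auto

lemma proper_cover_t_pass:
  assumes "distinct (elements (left G))" "proper_cover G X"
  shows "proper_cover G (t_pass G L X)"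
  using assms(2) unfolding t_pass_def
  by (induction L arbitrary: X) (auto simp: proper_cover_t_improve[OF assms(1)])

lemma t_search_correct:
  assumes "distinct (elements (left (left x)))" "proper_cover (left x) (left (left x))"
  shows "proper_cover (left x) (t_search x)"
    and "l \<in> set (elements (right x)) \<Longrightarrow> t_improve (left x) l (t_search x) = t_search x"
proof -
  have "proper_cover (left x) ((t_pass (left x) (right x) ^^ n) (left (left x)))" for n
    using assms by (induction n) (auto simp: proper_cover_t_pass)
  then show "proper_cover (left x) (t_search x)" by (simp add: t_search_eq)
next
  let ?g = "t_pass (left x) (right x)"
  have "?g (t_search x) = t_search x"
    unfolding t_search_eq
    by (rule funpow_stable[where \<mu> = "\<lambda>X. length (elements X)"]) (use t_pass_cases in auto)
  then show "l \<in> set (elements (right x)) \<Longrightarrow> t_improve (left x) l (t_search x) = t_search x"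
    using t_pass_cases[of "left x" "right x" "t_search x"] by auto
qed

definition t_local_search :: "nat \<Rightarrow> tree \<Rightarrow> tree" where
  "t_local_search m G = t_search ((t_square ^^ m) (t_start G))"

lemma t_local_search_correct:
  assumes "distinct (elements (left G))" "proper_cover G (left G)"
  shows "proper_cover G (t_local_search m G)"
    and "proper_cover G Y \<Longrightarrow>
      card (set (elements (t_local_search m G)) - set (elements Y) \<union>
        (set (elements Y) - set (elements (t_local_search m G)))) \<le> 2 ^ m \<Longrightarrow>
      length (elements (t_local_search m G)) \<le> length (elements Y)"
proof -
  define x where "x = (t_square ^^ m) (t_start G)"
  have x: "left x = G" by (simp add: x_def)
  define X where "X = t_local_search m G"
  have X: "X = t_search x" by (simp add: X_def t_local_search_def x_def)
  show 1: "proper_cover G (t_local_search m G)"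
    using t_search_correct(1)[of x] assms x by (simp add: t_local_search_def x_def)
  assume Y: "proper_cover G Y"
  let ?X = "set (elements X)" and ?Y = "set (elements Y)"
  let ?S = "?X - ?Y \<union> (?Y - ?X)"
  assume "card (set (elements (t_local_search m G)) - set (elements Y) \<union>
        (set (elements Y) - set (elements (t_local_search m G)))) \<le> 2 ^ m"
  then have c: "card ?S \<le> 2 ^ m" unfolding X_def .
  have "length (elements X) \<le> length (elements Y)"
  proof (cases "?S = {}")
    case True
    then have "?X = ?Y" by auto
    with 1 Y show ?thesis unfolding X_def[symmetric] proper_cover_def
      by (metis distinct_card order_refl)
  next
    case False
    have "?S \<subseteq> set (elements (left G))"
      using 1 Y unfolding X_def[symmetric] proper_cover_def by auto
    from subset_listed[OF this False c] obtain l where l: "l \<in> set (elements (right x))"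
      "set (elements l) = ?S" unfolding x_def by blast
    \<comment> \<open>Flipping \<open>X\<close> along its symmetric difference with \<open>Y\<close>
      yields \<open>Y\<close> as a set. As the search is stable, this candidate was rejected; it is
      a cover, so it cannot be shorter.\<close>
    let ?F = "t_flip (left G) X l"
    have F: "set (elements ?F) = ?Y"
      using 1 Y l(2) unfolding X_def[symmetric] proper_cover_def by (auto simp: elements_t_flip)
    then have cov: "tree_cover (right G) ?F" using Y by (simp add: proper_cover_def tree_cover_def)
    have "distinct (elements ?F)" using assms(1) by (simp add: elements_t_flip)
    then have len: "length (elements ?F) = length (elements Y)"
      using F Y unfolding proper_cover_def by (metis distinct_card)
    have "t_improve G l X = X"
      using t_search_correct(2)[of x l] l(1) assms x X by simp
    then have "\<not> length (elements ?F) < length (elements X)"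
      using cov by (auto simp: t_improve_def split: if_splits)
    with len show ?thesis by simp
  qed
  then show "length (elements (t_local_search m G)) \<le> length (elements Y)" by (simp add: X_def)
qed

lemma elements_inject: "elements X = elements Y \<Longrightarrow> X = Y"
proof (induction X arbitrary: Y)
  case Leaf
  then show ?case by (cases Y) auto
next
  case (Node a X)
  then show ?case by (cases Y) auto
qed

lemma local_search_correct:
  assumes x: "codes_graph x G" and G: "simple_graph G"
  shows "\<exists>X. codes_set (t_local_search m x) X \<and> vertex_cover G X \<and>
    (\<forall>Y. vertex_cover G Y \<longrightarrow> card (X - Y \<union> (Y - X)) \<le> 2 ^ m \<longrightarrow> card X \<le> card Y)"
proof -
  obtain vs es where vs: "distinct vs" "set vs = verts G"
    and es: "set (map (\<lambda>(v, w). {v, w}) es) = edges G"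
    and xeq: "x = Node (code_list code_nat vs) (code_list code_pair es)"
    using x unfolding codes_graph_def by blast
  have inj: "inj_on code_nat A" for A by (auto intro: inj_onI)
  have es': "{v, w} \<in> edges G \<longleftrightarrow> (v, w) \<in> set es \<or> (w, v) \<in> set es" for v w
  proof -
    have "{v, w} \<in> edges G \<longleftrightarrow> (\<exists>(a, b) \<in> set es. {v, w} = {a, b})"
      unfolding es[symmetric] by auto
    then show ?thesis by (auto simp: doubleton_eq_iff)
  qed
  have codes: "tree_cover (right x) (code_list code_nat xs) \<longleftrightarrow>
      (\<forall>v w. {v, w} \<in> edges G \<longrightarrow> v \<in> set xs \<or> w \<in> set xs)" for xs
    unfolding tree_cover_def xeq es' by (fastforce simp: image_iff)
  have proper: "proper_cover x (code_list code_nat xs) \<longleftrightarrow> distinct xs \<and> vertex_cover G (set xs)" for xs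
    unfolding proper_cover_def codes vertex_cover_def vs(2)[symmetric]
    by (auto simp: xeq distinct_map inj)
  have cover: "proper_cover x (left x)" "distinct (elements (left x))"
    using proper[of vs] vs G by (auto simp: xeq distinct_map inj vertex_cover_def simple_graph_def)
  note search = t_local_search_correct[OF cover(2,1), where m = m]
  have "set (elements (t_local_search m x)) \<subseteq> code_nat ` set vs"
    using search(1) unfolding proper_cover_def by (simp add: xeq)
  then have "\<exists>xs. elements (t_local_search m x) = map code_nat xs"
    unfolding ex_map_conv by blast
  then obtain xs where xs: "elements (t_local_search m x) = map code_nat xs" by blast
  have code: "t_local_search m x = code_list code_nat xs"
    using xs by (metis elements_code_list elements_inject)
  have "card (set xs) \<le> card Y"
    if Y: "vertex_cover G Y" "card (set xs - Y \<union> (Y - set xs)) \<le> 2 ^ m" for Y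
  proof -
    have "finite Y" using Y(1) vs unfolding vertex_cover_def by (metis finite_set finite_subset)
    then obtain ys where ys: "set ys = Y" "distinct ys" using finite_distinct_list by blast
    have "code_nat ` set xs - code_nat ` Y \<union> (code_nat ` Y - code_nat ` set xs)
        = code_nat ` (set xs - Y \<union> (Y - set xs))" by auto
    then have "length xs \<le> length ys"
      using search(2)[of "code_list code_nat ys"] Y ys proper[of ys]
      by (simp add: xs card_image inj)
    then show ?thesis using ys card_length le_trans distinct_card by metis
  qed
  moreover have "codes_set (t_local_search m x) (set xs)" "vertex_cover G (set xs)"
    using search(1) code proper[of xs] unfolding codes_set_def by auto
  ultimately show ?thesis by blast
qed


section \<open>Uniformity\<close>

text \<open>A logarithm that a program obtains by folding over the binary code, without
  arithmetic.\<close>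

definition bit_length :: "nat \<Rightarrow> nat" where
  "bit_length n = length (elements (code_nat n))"

lemma less_two_power_bit_length: "n < 2 ^ bit_length n"
proof (induction n rule: less_induct)
  case (less n)
  show ?case
  proof (cases "n = 0")
    case False
    then have "bit_length n = Suc (bit_length (n div 2))"
      by (simp add: bit_length_def code_nat.simps[of n])
    moreover have "n div 2 < 2 ^ bit_length (n div 2)" using False less.IH[of "n div 2"] by simp
    ultimately show ?thesis by simp
  qed (simp add: bit_length_def)
qed

lemma computes_funpow:
  assumes "computes b p f q" "computes b r g q0"
  shows "\<exists>q'. computes b ((Seq p ^^ m) r) (\<lambda>x. g ((f ^^ m) x)) q'"
proof (induction m)
  case 0
  with assms(2) show ?case by auto
next
  case (Suc m)
  then obtain q' where "computes b ((Seq p ^^ m) r) (\<lambda>x. g ((f ^^ m) x)) q'" by blast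
  from computes_comp[OF assms(1) this] show ?case by (auto simp: funpow_swap1)
qed

lemma computes_runs:
  assumes "computes 0 p f q"
  shows "\<exists>t. runs p x t (f x) \<and> t \<le> poly q (nodes x)"
proof -
  obtain t s' where "exec p ((\<lambda>_. Leaf)(0 := x)) t s'" "t \<le> poly q (nodes x)" "s' 0 = f x"
    using computesE[OF assms, of "(\<lambda>_. Leaf)(0 := x)"] by (metis fun_upd_same)
  then show ?thesis unfolding runs_def by blast
qed

text \<open>Because \<open>A m\<close> nests \<open>m\<close> copies of \<open>square\<close>, its
  code arises from that of \<open>search\<close> by applying a constant context \<open>W\<close> to
  a tree \<open>m\<close> times and adding the code of \<open>start\<close>. A fold over the digits
  of the denominator can do this. It applies \<open>W\<close> twice per digit since the radius grows
  with the square of the inverse accuracy; \<open>c\<close> makes room for the constant that stems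
  from the excluded minor.\<close>

lemma local_search_programs:
  "\<exists>A :: nat \<Rightarrow> prog. (\<forall>m. \<exists>q. computes 0 (A m) (t_local_search m) q) \<and>
    (\<forall>c. \<exists>U. \<forall>q. outputs U (code_rat q)
      (code_prog (A (c + 2 * bit_length (nat (snd (quotient_of q)))))))"
proof -
  obtain start qs where start: "computes 0 start t_start qs"
    using ptime_start unfolding ptime_def by blast
  obtain square qq where square: "computes 0 square t_square qq"
    using ptime_square unfolding ptime_def by blast
  obtain search ql where search: "computes 0 search t_search ql"
    using ptime_search unfolding ptime_def by blast
  define A where "A m = Seq start ((Seq square ^^ m) search)" for m
  define W where "W z = Node (code_nat 1) (Node (code_prog square) z)" for z
  have code: "code_prog ((Seq square ^^ m) r) = (W ^^ m) (code_prog r)" for m r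
    by (induction m) (auto simp: W_def)
  have "\<exists>q. computes 0 (A m) (t_local_search m) q" for m
    using computes_funpow[OF square search, of m] computes_comp[OF start]
    unfolding A_def t_local_search_def[abs_def] by meson
  moreover have "\<exists>U. \<forall>q. outputs U (code_rat q)
      (code_prog (A (c + 2 * bit_length (nat (snd (quotient_of q))))))" for c
  proof -
    define u where "u x = Node (code_nat 1) (Node (code_prog start)
      (tfold (\<lambda>_ z. W (W z)) (right x) ((W ^^ c) (code_prog search))))" for x
    have W: "ptime (\<lambda>x. W (f x))" if "ptime f" for f
      unfolding W_def by (intro ptime_intros that)
    have "ptime (\<lambda>x. tfold ((\<lambda>_ _ z. W (W z)) Leaf) (right x) ((W ^^ c) (code_prog search)))"
    proof (rule ptime_tfold[where c = "\<lambda>_. Leaf"])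
      fix x a z
      show "nodes (W (W z)) \<le> nodes z
          + poly [:2 * (2 + nodes (code_nat 1) + nodes (code_prog square)):] (nodes x + nodes a)"
        by (simp add: W_def)
    qed (intro W ptime_intros)+
    then have "ptime u" unfolding u_def[abs_def] by (intro ptime_intros) simp
    then obtain U q where U: "computes 0 U u q" unfolding ptime_def by blast
    have "tfold (\<lambda>_ z. W (W z)) l z = (W ^^ (2 * length (elements l))) z" for l z
      by (induction l arbitrary: z) (auto simp: funpow_swap1)
    then have "u (code_rat q) = code_prog (A (c + 2 * bit_length (nat (snd (quotient_of q)))))" for q
      unfolding u_def A_def code_rat_def bit_length_def
      by (simp add: code add.commute[of c] funpow_add)
    with computes_runs[OF U] show ?thesis unfolding outputs_def by metis
  qed
  ultimately show ?thesis by blast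
qed

section \<open>Connected sets and separators\<close>

text \<open>For symmetric \<open>adj\<close> and finite \<open>W\<close> these are the unions of
  components of the graph induced on \<open>W\<close>; they replace reachability by walks.\<close>

definition closed_in :: "('a \<Rightarrow> 'a \<Rightarrow> bool) \<Rightarrow> 'a set \<Rightarrow> 'a set \<Rightarrow> bool" where
  "closed_in adj W P \<longleftrightarrow> P \<subseteq> W \<and> (\<forall>u\<in>P. \<forall>w\<in>W. adj u w \<longrightarrow> w \<in> P)"

definition conn :: "('a \<Rightarrow> 'a \<Rightarrow> bool) \<Rightarrow> 'a set \<Rightarrow> bool" where
  "conn adj S \<longleftrightarrow> S \<noteq> {} \<and> (\<forall>P. P \<noteq> {} \<longrightarrow> closed_in adj S P \<longrightarrow> P = S)"

definition component :: "('a \<Rightarrow> 'a \<Rightarrow> bool) \<Rightarrow> 'a set \<Rightarrow> 'a set \<Rightarrow> bool" where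
  "component adj W K \<longleftrightarrow> conn adj K \<and> closed_in adj W K"

definition nbhd :: "('a \<Rightarrow> 'a \<Rightarrow> bool) \<Rightarrow> 'a set \<Rightarrow> 'a set \<Rightarrow> 'a set" where
  "nbhd adj U B = {w \<in> U - B. \<exists>u\<in>B. adj u w}"

text \<open>A \<open>K\<^sub>n\<close> minor with \<open>n = card \<C>\<close>, given by its branch
  sets. Subgraphs and contraction sequences appear only when \<open>minor\<close> has to be
  established.\<close>

definition clique_model :: "('a \<Rightarrow> 'a \<Rightarrow> bool) \<Rightarrow> 'a set \<Rightarrow> 'a set set \<Rightarrow> bool" where
  "clique_model adj U \<C> \<longleftrightarrow> finite \<C> \<and> (\<forall>C\<in>\<C>. C \<subseteq> U \<and> conn adj C) \<and>
     (\<forall>C\<in>\<C>. \<forall>D\<in>\<C>. C \<noteq> D \<longrightarrow> C \<inter> D = {} \<and> (\<exists>u\<in>C. \<exists>w\<in>D. adj u w))"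

definition separation ::
  "('a \<Rightarrow> 'a \<Rightarrow> bool) \<Rightarrow> 'a set \<Rightarrow> 'a set \<Rightarrow> 'a set \<Rightarrow> 'a set \<Rightarrow> bool" where
  "separation adj U Y P Q \<longleftrightarrow> U = Y \<union> P \<union> Q \<and> Y \<inter> P = {} \<and> Y \<inter> Q = {} \<and> P \<inter> Q = {} \<and>
     (\<forall>u\<in>P. \<forall>w\<in>Q. \<not> adj u w)"

lemma closed_in_refl: "closed_in adj W W"
  by (auto simp: closed_in_def)

lemma conn_singleton: "conn adj {v}"
  by (auto simp: conn_def closed_in_def)

lemma conn_nonempty: "conn adj S \<Longrightarrow> S \<noteq> {}"
  by (simp add: conn_def)

lemma connD: "conn adj S \<Longrightarrow> closed_in adj S P \<Longrightarrow> P \<noteq> {} \<Longrightarrow> P = S"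
  by (simp add: conn_def)

text \<open>Used where one would otherwise follow a walk inside \<open>S\<close>: the intersection
  \<open>S \<inter> P\<close> is closed in \<open>S\<close>.\<close>

lemma conn_subset_closed:
  assumes "conn adj S" "closed_in adj W P" "S \<subseteq> W" "S \<inter> P \<noteq> {}"
  shows "S \<subseteq> P"
proof -
  have "closed_in adj S (S \<inter> P)" using assms(2,3) by (auto simp: closed_in_def)
  then have "S \<inter> P = S" by (rule connD[OF assms(1) _ assms(4)])
  then show ?thesis by blast
qed

lemma conn_Union:
  assumes "C \<noteq> {}" "\<And>T. T \<in> \<T> \<Longrightarrow> conn adj (C \<union> T)" "conn adj C"
  shows "conn adj (C \<union> \<Union>\<T>)"
  unfolding conn_def
proof (intro conjI allI impI)
  fix P
  assume P: "P \<noteq> {}" "closed_in adj (C \<union> \<Union>\<T>) P"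
  have T: "C \<union> T \<subseteq> P" if "T \<in> \<T>" "(C \<union> T) \<inter> P \<noteq> {}" for T
    using that by (intro conn_subset_closed[OF assms(2) P(2)]) auto
  have PS: "P \<subseteq> C \<union> \<Union>\<T>" using P(2) by (simp add: closed_in_def)
  have "C \<subseteq> P"
  proof (cases "C \<inter> P = {}")
    case True
    with P(1) PS obtain T where "T \<in> \<T>" "(C \<union> T) \<inter> P \<noteq> {}" by blast
    from T[OF this] show ?thesis by simp
  next
    case False
    then show ?thesis by (intro conn_subset_closed[OF assms(3) P(2)]) auto
  qed
  then have "(C \<union> T) \<inter> P \<noteq> {}" for T using assms(1) by auto
  with T have "\<Union>\<T> \<subseteq> P" by (simp add: Sup_least)
  with \<open>C \<subseteq> P\<close> PS show "P = C \<union> \<Union>\<T>"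
    by (intro subset_antisym Un_least)
qed (use assms(1) in simp)

context
  fixes adj :: "'a \<Rightarrow> 'a \<Rightarrow> bool"
  assumes sym: "\<And>u w. adj u w \<Longrightarrow> adj w u"
begin

lemma conn_Un:
  assumes "conn adj S" "conn adj T" "u \<in> S" "w \<in> T" "adj u w"
  shows "conn adj (S \<union> T)"
  unfolding conn_def
proof (intro conjI allI impI)
  fix P
  assume P: "P \<noteq> {}" "closed_in adj (S \<union> T) P"
  have S: "S \<subseteq> P" if "S \<inter> P \<noteq> {}"
    by (rule conn_subset_closed[OF assms(1) P(2) _ that]) simp
  have T: "T \<subseteq> P" if "T \<inter> P \<noteq> {}"
    by (rule conn_subset_closed[OF assms(2) P(2) _ that]) simp
  have "S \<inter> P \<noteq> {} \<or> T \<inter> P \<noteq> {}" using P unfolding closed_in_def by blast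
  then have "u \<in> P \<or> w \<in> P" using S T assms by blast
  then have "u \<in> P" "w \<in> P" using P(2) assms sym unfolding closed_in_def by blast+
  with S T assms have "S \<union> T \<subseteq> P" by blast
  with P(2) show "P = S \<union> T" unfolding closed_in_def by blast
qed (use assms in auto)

lemma conn_insert:
  assumes "conn adj S" "u \<in> S" "adj u w"
  shows "conn adj (insert w S)"
  using conn_Un[OF assms(1) conn_singleton[of _ w] assms(2) _ assms(3)] by simp

lemma closed_in_Diff:
  assumes "closed_in adj W P"
  shows "closed_in adj W (W - P)"
  using assms sym unfolding closed_in_def by blast

lemma component_exists:
  assumes "finite W" "W \<noteq> {}"
  shows "\<exists>K. component adj W K"
proof -
  let ?F = "{P. P \<noteq> {} \<and> closed_in adj W P}"
  have "W \<in> ?F" using assms closed_in_refl by blast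
  moreover have "finite ?F" by (rule finite_subset[of _ "Pow W"]) (auto simp: closed_in_def assms)
  ultimately obtain K where K: "K \<in> ?F" "\<And>P. P \<in> ?F \<Longrightarrow> P \<subseteq> K \<Longrightarrow> P = K"
    using finite_has_minimal[of ?F] by blast
  have "conn adj K"
    unfolding conn_def
  proof (intro conjI allI impI)
    fix P assume "P \<noteq> {}" "closed_in adj K P"
    with K(1) have "P \<in> ?F" "P \<subseteq> K" unfolding closed_in_def by blast+
    then show "P = K" by (rule K(2))
  qed (use K in auto)
  with K(1) show ?thesis unfolding component_def by blast
qed

text \<open>Breadth-first search in \<open>k\<close> stacked copies of \<open>B\<close>, where one passes from copy \<open>i\<close> to
  copy \<open>i + 1\<close> at the vertices of \<open>A i\<close>: either the search is finished within \<open>r\<close> steps, or one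
  of \<open>r\<close> disjoint layers is small, and it separates \<open>B\<close> as desired. The search is phrased with
  connected sets in place of walks: \<open>R i c v\<close> corresponds to \<open>v\<close> in copy \<open>i\<close> being reached
  within \<open>c\<close> steps, and \<open>L i j\<close> is the part of a layer in copy \<open>i + 1\<close>.\<close>

lemma small_transversal_or_cut:
  fixes A :: "nat \<Rightarrow> 'a set"
  assumes fin: "finite B" and r: "r > 0"
  shows "(\<exists>T. conn adj T \<and> T \<subseteq> B \<and> card T \<le> r \<and> (\<forall>j<k. T \<inter> A j \<noteq> {})) \<or>
    (\<exists>Z\<subseteq>B. card Z * r \<le> k * card B \<and> (\<forall>D. conn adj D \<and> D \<subseteq> B - Z \<longrightarrow> (\<exists>i<k. D \<inter> A i = {})))"
proof (rule disj_imp[THEN iffD2, OF impI])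
  assume no_T: "\<not> (\<exists>T. conn adj T \<and> T \<subseteq> B \<and> card T \<le> r \<and> (\<forall>j<k. T \<inter> A j \<noteq> {}))"
  define R where "R i c v \<longleftrightarrow> (\<exists>T. conn adj T \<and> T \<subseteq> B \<and> v \<in> T \<and> card T \<le> c \<and> (\<forall>j<i. T \<inter> A j \<noteq> {}))"
    for i c v
  have R_mono: "R i c v \<Longrightarrow> c \<le> c' \<Longrightarrow> R i c' v" for i c c' v
    unfolding R_def by (meson le_trans)
  \<comment> \<open>For fixed \<open>i\<close> the layers \<open>L i j\<close> are disjoint, as
    \<open>R\<close> is monotone in the number of steps. Hence the sizes of \<open>Z 1\<close>, ...,
    \<open>Z r\<close> add up to at most \<open>k * card B\<close>, and one of them is at most the
    average.\<close>
  define L where "L i j = {v \<in> B. R (Suc i) (Suc j) v \<and> \<not> R (Suc i) j v}" for i j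
  define Z where "Z j = (\<Union>i<k. L i j)" for j
  have finL: "finite (L i j)" for i j unfolding L_def using fin by simp
  have "(\<Sum>j\<in>{1..r}. card (L i j)) \<le> card B" for i
  proof -
    have disj: "L i j \<inter> L i j' = {}" if "j < j'" for j j'
      unfolding L_def using R_mono[of "Suc i" "Suc j" _ j'] that by auto
    have "L i j \<inter> L i j' = {}" if "j \<noteq> j'" for j j'
      using that disj[of j j'] disj[of j' j] by (cases "j < j'") (simp_all add: Int_commute)
    then have "(\<Sum>j\<in>{1..r}. card (L i j)) = card (\<Union>j\<in>{1..r}. L i j)"
      by (intro card_UN_disjoint[symmetric]) (simp_all add: finL)
    also have "\<dots> \<le> card B" by (rule card_mono) (auto simp: fin L_def)
    finally show ?thesis .
  qed
  then have "(\<Sum>i<k. \<Sum>j\<in>{1..r}. card (L i j)) \<le> k * card B"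
    using sum_bounded_above[of "{..<k}" "\<lambda>i. \<Sum>j\<in>{1..r}. card (L i j)" "card B"] by simp
  then have le: "(\<Sum>j\<in>{1..r}. \<Sum>i<k. card (L i j)) \<le> k * card B"
    by (subst sum.swap)
  have "\<exists>j\<in>{1..r}. card (Z j) * r \<le> k * card B"
  proof (rule ccontr)
    assume "\<not> ?thesis"
    then have "(\<Sum>j\<in>{1..r}. k * card B) < (\<Sum>j\<in>{1..r}. card (Z j) * r)"
      using r by (intro sum_strict_mono) (auto simp: not_le)
    also have "\<dots> \<le> (\<Sum>j\<in>{1..r}. (\<Sum>i<k. card (L i j)) * r)"
      unfolding Z_def by (intro sum_mono mult_right_mono card_UN_le) auto
    also have "\<dots> \<le> k * card B * r"
      using le by (simp flip: sum_distrib_right)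
    finally show False by simp
  qed
  then obtain j where j: "1 \<le> j" "j \<le> r" "card (Z j) * r \<le> k * card B" by auto
  have "\<exists>i<k. D \<inter> A i = {}" if D: "conn adj D" "D \<subseteq> B - Z j" for D
  proof (rule ccontr)
    assume "\<not> ?thesis"
    then have meets: "D \<inter> A i \<noteq> {}" if "i < k" for i using that by blast
    \<comment> \<open>The same number \<open>j\<close> works for all copies. A vertex of
      \<open>D\<close> in \<open>A i\<close> passes to the next copy without a further step; from
      there \<open>j\<close> steps suffice throughout \<open>D\<close>, because a neighbour that
      needs one more would lie in \<open>L i j\<close>, which \<open>D\<close> avoids. For
      \<open>i = 0\<close> a singleton will do, as \<open>1 \<le> j\<close>.\<close>
    have "\<forall>v\<in>D. R i j v" if "i \<le> k" for i
      using that
    proof (induction i)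
      case 0
      show ?case
      proof
        fix v assume "v \<in> D"
        then show "R 0 j v" unfolding R_def using D(2) j(1)
          by (intro exI[of _ "{v}"]) (auto simp: conn_singleton)
      qed
    next
      case (Suc i)
      obtain v where v: "v \<in> D" "v \<in> A i" using meets[of i] Suc.prems by auto
      have "R i j v" using Suc v by simp
      then have "R (Suc i) j v" unfolding R_def using v(2) by (metis IntI empty_iff less_Suc_eq)
      moreover have "closed_in adj D {w \<in> D. R (Suc i) j w}"
        unfolding closed_in_def
      proof (intro conjI ballI impI)
        fix u w assume u: "u \<in> {w \<in> D. R (Suc i) j w}" and w: "w \<in> D" "adj u w"
        then obtain T where T: "conn adj T" "T \<subseteq> B" "u \<in> T" "card T \<le> j" "\<forall>l<Suc i. T \<inter> A l \<noteq> {}"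
          unfolding R_def by blast
        have "card (insert w T) \<le> Suc j" using T(4) card_insert_le_m1[of "Suc j" T w] by simp
        then have "R (Suc i) (Suc j) w" unfolding R_def
          using conn_insert[OF T(1,3) w(2)] T w(1) D(2) by (intro exI[of _ "insert w T"]) auto
        moreover have "w \<notin> L i j" using w(1) D(2) Suc.prems unfolding Z_def by auto
        ultimately have "R (Suc i) j w" unfolding L_def using w(1) D(2) by auto
        with w show "w \<in> {w \<in> D. R (Suc i) j w}" by simp
      qed auto
      ultimately have "{w \<in> D. R (Suc i) j w} = D"
        using v(1) by (intro connD[OF D(1)]) auto
      then show ?case by blast
    qed
    then have "\<forall>v\<in>D. R k j v" by simp
    with conn_nonempty[OF D(1)] obtain v where "R k j v" by blast
    with no_T j(2) show False unfolding R_def by (meson le_trans)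
  qed
  moreover have "Z j \<subseteq> B" unfolding Z_def L_def by auto
  ultimately show "\<exists>Z\<subseteq>B. card Z * r \<le> k * card B \<and>
      (\<forall>D. conn adj D \<and> D \<subseteq> B - Z \<longrightarrow> (\<exists>i<k. D \<inter> A i = {}))"
    using j(3) by blast
qed

lemma small_transversal_or_cut':
  fixes A :: "'b \<Rightarrow> 'a set"
  assumes fin: "finite B" "finite I" and r: "r > 0"
  shows "(\<exists>T. conn adj T \<and> T \<subseteq> B \<and> card T \<le> r \<and> (\<forall>i\<in>I. T \<inter> A i \<noteq> {})) \<or>
    (\<exists>Z\<subseteq>B. card Z * r \<le> card I * card B \<and>
      (\<forall>D. conn adj D \<and> D \<subseteq> B - Z \<longrightarrow> (\<exists>i\<in>I. D \<inter> A i = {})))"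
proof -
  obtain f n where I: "I = f ` {..<n}" and n: "card I = n"
    using ex_bij_betw_nat_finite[OF fin(2)] unfolding atLeast0LessThan bij_betw_def by metis
  have *: "(\<forall>i\<in>I. Q i) \<longleftrightarrow> (\<forall>i<n. Q (f i))" "(\<exists>i\<in>I. Q i) \<longleftrightarrow> (\<exists>i<n. Q (f i))" for Q
    by (auto simp: I)
  show ?thesis
    using small_transversal_or_cut[OF fin(1) r, of n "\<lambda>i. A (f i)"] unfolding * n .
qed

text \<open>The Alon--Seymour--Thomas argument. If every small set leaves a large component, one can
  shrink a large connected set \<open>B\<close> whose neighbourhood is spread over the branch sets of a clique
  model, with at most \<open>r\<close> neighbours in each: either a small connected subset of \<open>B\<close> is adjacent
  to all branch sets and becomes a new one, or a small cut shields a large part of \<open>B\<close> from one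
  branch set, which then absorbs everything on its side of the cut.\<close>

lemma clique_model_grows:
  assumes fin: "finite U" and r: "r > 0" "h * card U \<le> r * r"
  assumes big: "\<And>Y. Y \<subseteq> U \<Longrightarrow> card Y \<le> h * r \<Longrightarrow>
      \<exists>K. component adj (U - Y) K \<and> card U < 2 * card K"
  assumes "conn adj B" "B \<subseteq> U" "card U < 2 * card B"
    and "clique_model adj (U - B) \<C>" "card \<C> \<le> h"
    and "nbhd adj U B \<subseteq> \<Union>\<C>" "\<And>C. C \<in> \<C> \<Longrightarrow> card (nbhd adj U B \<inter> C) \<le> r"
  shows "\<exists>\<D>. clique_model adj U \<D> \<and> card \<D> = h"
  using assms(5-)
\<comment> \<open>The set \<open>B\<close> shrinks whenever the model gains or enlarges a branch
  set. As the model never has more than \<open>h\<close> members, the weight \<open>Suc h\<close>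
  outweighs a new one; when a branch set is dropped, \<open>B\<close> stays the same.\<close>
proof (induction "card B * Suc h + card \<C>" arbitrary: B \<C> rule: less_induct)
  case (less B \<C>)
  note B = less.prems(1-3) and C = less.prems(4,5) and N = less.prems(6,7)
  have finC: "finite \<C>" using C(1) unfolding clique_model_def by simp
  have finB: "finite B" using B(2) fin finite_subset by blast
  show ?case
  proof (cases "card \<C> = h")
    case True
    with C(1) have "clique_model adj U \<C>" unfolding clique_model_def by blast
    with True show ?thesis by blast
  next
    case False
    with C(2) have k: "card \<C> < h" by simp
    show ?thesis
    \<comment> \<open>A branch set not adjacent to \<open>B\<close> is dropped. Otherwise every
      \<open>A C\<close> is nonempty, which later makes \<open>B - E\<close> strictly smaller than
      \<open>B\<close>.\<close>
    proof (cases "\<exists>C\<in>\<C>. nbhd adj U B \<inter> C = {}")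
      case True
      then obtain C where C0: "C \<in> \<C>" "nbhd adj U B \<inter> C = {}" by blast
      have "card (\<C> - {C}) < card \<C>" using C0 finC by (intro card_Diff1_less)
      moreover have "nbhd adj U B \<subseteq> \<Union>(\<C> - {C})" using N(1) C0(2) by blast
      moreover have "clique_model adj (U - B) (\<C> - {C})" using C(1) by (simp add: clique_model_def)
      ultimately show ?thesis
        using C(2) N(2) by (intro less.hyps[OF _ B, of "\<C> - {C}"]) auto
    next
      case False
      define A where "A C = {u \<in> B. \<exists>w\<in>C. adj u w}" for C
      have A_ne: "A C \<noteq> {}" if "C \<in> \<C>" for C
        using False that unfolding nbhd_def A_def by blast
      have "card (nbhd adj U B) = card (\<Union>C\<in>\<C>. nbhd adj U B \<inter> C)"
        using N(1) by (intro arg_cong[where f = card]) auto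
      also have "\<dots> \<le> (\<Sum>C\<in>\<C>. card (nbhd adj U B \<inter> C))" by (rule card_UN_le[OF finC])
      also have "\<dots> \<le> card \<C> * r" using N(2) sum_bounded_above[of \<C> _ r] by simp
      finally have cN: "card (nbhd adj U B) \<le> card \<C> * r" .
      have cY: "card (nbhd adj U B \<union> T) \<le> h * r" if "card T \<le> r" for T
      proof -
        have "card (nbhd adj U B \<union> T) \<le> card \<C> * r + r"
          using card_Un_le[of "nbhd adj U B" T] cN that by linarith
        also have "\<dots> = Suc (card \<C>) * r" by simp
        also have "\<dots> \<le> h * r" using k by (intro mult_le_mono1) simp
        finally show ?thesis .
      qed
      \<comment> \<open>The removed set has at most \<open>h * r\<close> vertices, so a large
        component \<open>K\<close> remains. It meets \<open>B\<close>, since both have more than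
        half of \<open>U\<close>; and \<open>B - T\<close> is closed in what remains, so
        \<open>K\<close> lies inside.\<close>
      have shrink: "\<exists>K. conn adj K \<and> K \<subseteq> B - T \<and> card U < 2 * card K \<and> nbhd adj U K \<subseteq> nbhd adj U B \<union> T"
        if T: "T \<subseteq> B" "card T \<le> r" for T
      proof -
        have "nbhd adj U B \<union> T \<subseteq> U" using T B(2) unfolding nbhd_def by blast
        from big[OF this cY[OF T(2)]] obtain K where
          K: "component adj (U - (nbhd adj U B \<union> T)) K" "card U < 2 * card K" by blast
        have KU: "K \<subseteq> U - (nbhd adj U B \<union> T)" "conn adj K"
          using K(1) unfolding component_def closed_in_def by auto
        have "K \<inter> B \<noteq> {}"
        proof
          assume "K \<inter> B = {}"
          then have "card K + card B = card (K \<union> B)"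
            using KU fin finB by (intro card_Un_disjoint[symmetric]) (auto intro: finite_subset)
          also have "\<dots> \<le> card U" using KU B(2) fin by (intro card_mono) auto
          finally show False using K(2) B(3) by linarith
        qed
        moreover have "closed_in adj (U - (nbhd adj U B \<union> T)) (B - T)"
          using B(2) unfolding closed_in_def nbhd_def by blast
        ultimately have "K \<subseteq> B - T"
          using conn_subset_closed[OF KU(2)] KU(1) by blast
        moreover have "nbhd adj U K \<subseteq> nbhd adj U B \<union> T"
          using K(1) unfolding component_def closed_in_def nbhd_def[of adj U K] by blast
        ultimately show ?thesis using KU K(2) by blast
      qed
      from small_transversal_or_cut'[OF finB finC r(1), of A]
      show ?thesis
      proof (elim disjE exE conjE)
        fix T assume T: "conn adj T" "T \<subseteq> B" "card T \<le> r" "\<forall>C\<in>\<C>. T \<inter> A C \<noteq> {}"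
        obtain K where K: "conn adj K" "K \<subseteq> B - T" "card U < 2 * card K"
          "nbhd adj U K \<subseteq> nbhd adj U B \<union> T" using shrink[OF T(2,3)] by blast
        have KB: "card K < card B"
          using K(2) T(2) conn_nonempty[OF T(1)] finB by (intro psubset_card_mono) auto
        have le: "card (insert T \<C>) \<le> h" using k finC by (simp add: card_insert_if)
        have model: "clique_model adj (U - K) (insert T \<C>)"
        proof -
          have CB: "C \<subseteq> U - B" if "C \<in> \<C>" for C
            using C(1) that by (simp add: clique_model_def)
          have "T \<inter> C = {}" "\<exists>u\<in>T. \<exists>w\<in>C. adj u w" if "C \<in> \<C>" for C
            using CB[OF that] T(2) T(4)[rule_format, OF that] unfolding A_def by auto
          moreover from this have "\<exists>u\<in>C. \<exists>w\<in>T. adj u w" if "C \<in> \<C>" for C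
            using that sym by meson
          moreover have "C \<subseteq> U - K" if "C \<in> \<C>" for C using CB[OF that] K(2) by auto
          moreover have "T \<subseteq> U - K" using K(2) T(2) B(2) by auto
          ultimately show ?thesis using C(1) T(1) unfolding clique_model_def
            by (simp add: Int_commute)
        qed
        have nb: "nbhd adj U K \<subseteq> \<Union>(insert T \<C>)" using K(4) N(1) by blast
        have "card K * Suc h + card (insert T \<C>) < card B * Suc h + card \<C>"
        proof -
          have "Suc (card K) * Suc h \<le> card B * Suc h" using KB by (intro mult_le_mono1) simp
          then show ?thesis using le by simp
        qed
        moreover have "card (nbhd adj U K \<inter> D) \<le> r" if "D \<in> insert T \<C>" for D
        proof (cases "D = T")
          case True
          have "card (nbhd adj U K \<inter> T) \<le> card T"
            using T(2) finB by (intro card_mono) (auto intro: finite_subset)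
          with True T(3) show ?thesis by simp
        next
          case False
          with that have D: "D \<in> \<C>" by simp
          then have "nbhd adj U K \<inter> D \<subseteq> nbhd adj U B \<inter> D"
            using K(4) T(2) C(1) unfolding clique_model_def by blast
          moreover have "finite (nbhd adj U B \<inter> D)" using fin unfolding nbhd_def by simp
          ultimately show ?thesis using N(2)[OF D] by (meson card_mono le_trans)
        qed
        ultimately show ?thesis
          using K B(2) by (intro less.hyps[OF _ K(1) _ K(3) model le nb]) auto
      next
        fix Z assume Z: "Z \<subseteq> B" "card Z * r \<le> card \<C> * card B"
          "\<forall>D. conn adj D \<and> D \<subseteq> B - Z \<longrightarrow> (\<exists>C\<in>\<C>. D \<inter> A C = {})"
        have "card Z * r \<le> h * card U"
          using Z(2) C(2) card_mono[OF fin B(2)] by (meson le_trans mult_le_mono)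
        \<comment> \<open>This is what \<open>h * card U \<le> r * r\<close> is for: the cut is as
          small as a transversal would be.\<close>
        then have cZ: "card Z \<le> r" using r by (metis le_trans mult_le_cancel2)
        obtain K where K: "conn adj K" "K \<subseteq> B - Z" "card U < 2 * card K"
          "nbhd adj U K \<subseteq> nbhd adj U B \<union> Z" using shrink[OF Z(1) cZ] by blast
        then obtain C where C0: "C \<in> \<C>" "K \<inter> A C = {}" using Z(3) by blast
        have connC: "conn adj C" and CU: "C \<subseteq> U - B" using C0(1) C(1) unfolding clique_model_def by auto
        \<comment> \<open>Their union \<open>E\<close> consists of the components of
          \<open>B - K\<close> that are adjacent to \<open>C\<close>. It contains
          \<open>A C\<close>, because \<open>K\<close> avoids \<open>A C\<close>; so
          \<open>B - E\<close> has no neighbours left in \<open>C\<close> itself.\<close>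
        define \<T> where "\<T> = {T. conn adj T \<and> T \<subseteq> B - K \<and> T \<inter> A C \<noteq> {}}"
        define E where "E = \<Union>\<T>"
        have EB: "E \<subseteq> B - K" unfolding E_def \<T>_def by blast
        have AE: "A C \<subseteq> E"
        proof
          fix v assume "v \<in> A C"
          then have "{v} \<in> \<T>" using C0(2) unfolding \<T>_def A_def by (auto simp: conn_singleton)
          then show "v \<in> E" unfolding E_def by blast
        qed
        have E_closed: "w \<in> E" if "u \<in> E" "w \<in> B - K" "adj u w" for u w
        proof -
          from that(1) obtain T where T: "T \<in> \<T>" "u \<in> T" unfolding E_def by blast
          then have "insert w T \<in> \<T>" using that(2,3) conn_insert unfolding \<T>_def by blast
          then show ?thesis unfolding E_def by blast
        qed
        have from_K: "u \<in> K" if "u \<in> B - E" "w \<in> E" "adj u w" for u w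
          using E_closed[OF that(2) _ sym[OF that(3)]] that(1) by blast
        have connCE: "conn adj (C \<union> E)"
          unfolding E_def
        proof (rule conn_Union[OF conn_nonempty[OF connC] _ connC])
          fix T assume "T \<in> \<T>"
          then obtain u w where "conn adj T" "u \<in> T" "w \<in> C" "adj u w"
            unfolding \<T>_def A_def by blast
          then show "conn adj (C \<union> T)" using conn_Un[OF connC] sym by blast
        qed
        \<comment> \<open>An edge from \<open>B - E\<close> to \<open>E\<close> starts in
          \<open>K\<close>. So a closed part of \<open>B - E\<close> that misses \<open>K\<close> is
          closed in \<open>B\<close>, and one that contains \<open>K\<close> becomes closed in
          \<open>B\<close> when \<open>E\<close> is added. In both cases connectedness of
          \<open>B\<close> decides.\<close>
        have connBE: "conn adj (B - E)"
          unfolding conn_def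
        proof (intro conjI allI impI)
          show "B - E \<noteq> {}" using conn_nonempty[OF K(1)] EB K(2) by blast
        next
          fix P assume P: "P \<noteq> {}" "closed_in adj (B - E) P"
          have KBE: "K \<subseteq> B - E" using EB K(2) by blast
          show "P = B - E"
          proof (cases "K \<inter> P = {}")
            case True
            then have "closed_in adj B P" using P(2) from_K unfolding closed_in_def by blast
            then have "P = B" by (rule connD[OF B(1) _ P(1)])
            with True K conn_nonempty[OF K(1)] show ?thesis by blast
          next
            case False
            then have "K \<subseteq> P" using conn_subset_closed[OF K(1) P(2) KBE] by blast
            then have "closed_in adj B (P \<union> E)"
              using P(2) E_closed EB unfolding closed_in_def by blast
            then have "P \<union> E = B" using P(1) by (intro connD[OF B(1)]) auto
            then show ?thesis using P(2) unfolding closed_in_def by blast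
          qed
        qed
        \<comment> \<open>Neighbours of \<open>B - E\<close> in \<open>E\<close> are seen from
          \<open>K\<close> only, hence lie in \<open>Z\<close>. The enlarged branch set
          \<open>C \<union> E\<close> thus again contains at most \<open>r\<close>
          neighbours.\<close>
        have nb: "nbhd adj U (B - E) \<subseteq> (nbhd adj U B - C) \<union> (E \<inter> Z)"
        proof
          fix w assume "w \<in> nbhd adj U (B - E)"
          then obtain u where w: "w \<in> U" "w \<notin> B - E" "u \<in> B - E" "adj u w" unfolding nbhd_def by blast
          show "w \<in> (nbhd adj U B - C) \<union> (E \<inter> Z)"
          proof (cases "w \<in> B")
            case True
            then have "w \<in> E" using w by blast
            moreover from this have "u \<in> K" using from_K w by blast
            ultimately have "w \<in> nbhd adj U K" using w EB unfolding nbhd_def by blast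
            then have "w \<in> Z" using K(4) True unfolding nbhd_def by blast
            with \<open>w \<in> E\<close> show ?thesis by blast
          next
            case False
            then have "w \<in> nbhd adj U B" using w unfolding nbhd_def by blast
            moreover have "w \<notin> C" using w AE unfolding A_def by blast
            ultimately show ?thesis by blast
          qed
        qed
        define \<D> where "\<D> = insert (C \<union> E) (\<C> - {C})"
        have disj: "C \<inter> D = {}" "E \<inter> D = {}" if "D \<in> \<C> - {C}" for D
          using that C(1) C0(1) EB unfolding clique_model_def by blast+
        have model: "clique_model adj (U - (B - E)) \<D>"
        proof -
          have "\<exists>u\<in>C. \<exists>w\<in>D. adj u w" if "D \<in> \<C> - {C}" for D
            using that C(1) C0(1) unfolding clique_model_def by (metis DiffE singletonI)
          then have "(C \<union> E) \<inter> D = {}" "\<exists>u\<in>C \<union> E. \<exists>w\<in>D. adj u w" if "D \<in> \<C> - {C}" for D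
            using that disj[OF that] by (simp_all add: Int_Un_distrib2 bex_Un)
          moreover from this have "\<exists>u\<in>D. \<exists>w\<in>C \<union> E. adj u w" if "D \<in> \<C> - {C}" for D
            using that sym by meson
          moreover have "D \<subseteq> U - (B - E)" if "D \<in> \<C>" for D
            using that C(1) unfolding clique_model_def by auto
          moreover have "C \<union> E \<subseteq> U - (B - E)" using CU EB B(2) by auto
          ultimately show ?thesis using C(1) connCE unfolding clique_model_def \<D>_def
            by (simp add: Int_commute)
        qed
        have "card \<D> \<le> card \<C>" unfolding \<D>_def
          using C0(1) finC by (metis card_Suc_Diff1 card_insert_le_m1 diff_Suc_1 finite_Diff order_refl zero_less_Suc)
        then have le: "card \<D> \<le> h" using k by simp
        have "A C \<noteq> {}" "A C \<subseteq> B" using A_ne[OF C0(1)] unfolding A_def by auto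
        then have lt: "card (B - E) < card B" using AE finB by (intro psubset_card_mono) auto
        have big': "card U < 2 * card (B - E)"
        proof -
          have "card K \<le> card (B - E)" using EB K(2) finB by (intro card_mono) auto
          with K(3) show ?thesis by simp
        qed
        have "card (B - E) * Suc h + card \<D> < card B * Suc h + card \<C>"
        proof -
          have "Suc (card (B - E)) * Suc h \<le> card B * Suc h" using lt by (intro mult_le_mono1) simp
          then show ?thesis using le by simp
        qed
        moreover have "nbhd adj U (B - E) \<subseteq> \<Union>\<D>" using nb N(1) unfolding \<D>_def by blast
        moreover have "card (nbhd adj U (B - E) \<inter> D) \<le> r" if "D \<in> \<D>" for D
        proof (cases "D = C \<union> E")
          case True
          have "nbhd adj U (B - E) \<inter> D \<subseteq> Z" using nb True CU EB unfolding nbhd_def by blast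
          moreover have "finite Z" using Z(1) finB finite_subset by blast
          ultimately show ?thesis using cZ by (meson card_mono le_trans)
        next
          case False
          with that have D: "D \<in> \<C> - {C}" unfolding \<D>_def by simp
          then have "nbhd adj U (B - E) \<inter> D \<subseteq> nbhd adj U B \<inter> D" using nb disj(2)[OF D] by blast
          moreover have "finite (nbhd adj U B \<inter> D)" using fin unfolding nbhd_def by simp
          ultimately have "card (nbhd adj U (B - E) \<inter> D) \<le> card (nbhd adj U B \<inter> D)"
            by (intro card_mono)
          then show ?thesis using N(2)[of D] D by auto
        qed
        moreover have "B - E \<subseteq> U" using B(2) by auto
        ultimately show ?thesis by (intro less.hyps[OF _ connBE _ big' model le])
      qed
    qed
  qed
qed

text \<open>Let \<open>P\<close> be a largest closed set with at most two thirds of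
  \<open>card U\<close> vertices and \<open>K\<close> a component of the rest. If \<open>K\<close>
  is not large either, then \<open>P \<union> K\<close>, \<open>W - P\<close> and
  \<open>W - K\<close> all exceed two thirds, the first by maximality and the others for want of a
  separation. But their sizes add up to \<open>2 * card W\<close>.\<close>

lemma large_component_if_no_separation:
  assumes fin: "finite U" and Y: "Y \<subseteq> U"
    and no_sep: "\<And>P Q. separation adj U Y P Q \<Longrightarrow> 3 * card P \<le> 2 * card U \<Longrightarrow> 2 * card U < 3 * card Q"
  shows "\<exists>K. component adj (U - Y) K \<and> 2 * card U < 3 * card K"
proof (rule ccontr)
  assume "\<not> ?thesis"
  then have small: "3 * card K \<le> 2 * card U" if "component adj (U - Y) K" for K
    using that by (meson not_le)
  define W where "W = U - Y"
  have finW: "finite W" using fin unfolding W_def by simp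
  have sep: "separation adj U Y P (W - P)" if "closed_in adj W P" for P
    using that Y unfolding separation_def closed_in_def W_def by blast
  let ?F = "{P. closed_in adj W P \<and> 3 * card P \<le> 2 * card U}"
  have "{} \<in> ?F" by (auto simp: closed_in_def)
  then obtain P where P: "P \<in> ?F" "\<And>Q. Q \<in> ?F \<Longrightarrow> card Q \<le> card P"
    using ex_has_greatest_nat[of "\<lambda>P. P \<in> ?F" "{}" card "Suc (card U)"] by auto
  have PW: "P \<subseteq> W" using P(1) unfolding closed_in_def by simp
  have cW: "card W \<le> card U" unfolding W_def using fin by (simp add: card_mono)
  have cWP: "card (W - P) + card P = card W"
    using PW finW by (metis card_Diff_subset card_mono finite_subset le_add_diff_inverse2)
  have big: "2 * card U < 3 * card (W - P)" using no_sep sep P(1) by blast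
  then have "W - P \<noteq> {}" by (metis card.empty mult_0_right not_less_zero)
  with finW obtain K where K: "component adj (W - P) K" using component_exists[of "W - P"] by blast
  have KW: "closed_in adj W K"
    using K closed_in_Diff[of W P] P(1) unfolding component_def closed_in_def by blast
  have K3: "3 * card K \<le> 2 * card U"
    using K KW by (intro small) (auto simp: component_def W_def)
  have K_props: "K \<subseteq> W - P" "K \<noteq> {}" "conn adj K"
    using K conn_nonempty unfolding component_def closed_in_def by blast+
  have finK: "finite K" "finite P" using K_props(1) PW finW finite_subset by (metis finite_Diff)+
  have cPK: "card (P \<union> K) = card P + card K"
    using K_props(1) finK by (intro card_Un_disjoint) auto
  have "closed_in adj W (P \<union> K)" using KW P(1) unfolding closed_in_def by blast
  moreover have "card P < card (P \<union> K)" using cPK K_props(2) finK by (simp add: card_gt_0_iff)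
  ultimately have "2 * card U < 3 * card (P \<union> K)" using P(2)[of "P \<union> K"] by force
  moreover have "2 * card U < 3 * card (W - K)" using no_sep[OF sep[OF KW] K3] .
  moreover have "card (W - K) + card K = card W"
    using K_props(1) finW finK by (metis Diff_subset card_Diff_subset card_mono le_add_diff_inverse2 subset_trans)
  ultimately show False using cPK cWP cW big by linarith
qed

text \<open>Without such a separation, every removal of at most \<open>h * r\<close> vertices leaves
  a large component. The one left by removing nothing has no neighbours, so the growth process can
  start there with the empty model.\<close>

theorem balanced_separation:
  assumes fin: "finite U" and r: "r > 0" "h * card U \<le> r * r"
    and no_model: "\<not> (\<exists>\<C>. clique_model adj U \<C> \<and> card \<C> = h)"
  shows "\<exists>Y P Q. separation adj U Y P Q \<and> card Y \<le> h * r \<and>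
    3 * card P \<le> 2 * card U \<and> 3 * card Q \<le> 2 * card U"
proof (rule ccontr)
  assume none: "\<not> ?thesis"
  have big: "\<exists>K. component adj (U - Y) K \<and> card U < 2 * card K" if "Y \<subseteq> U" "card Y \<le> h * r" for Y
  proof -
    have "\<exists>K. component adj (U - Y) K \<and> 2 * card U < 3 * card K"
      using none that by (intro large_component_if_no_separation[OF fin]) (meson not_le)+
    then obtain K where "component adj (U - Y) K" "2 * card U < 3 * card K" by blast
    then show ?thesis by (intro exI[of _ K]) auto
  qed
  from big[of "{}"] obtain K where "component adj U K" "card U < 2 * card K" by auto
  then have "conn adj K" "K \<subseteq> U" "card U < 2 * card K" "nbhd adj U K = {}"
    unfolding component_def closed_in_def nbhd_def by blast+
  then have "\<exists>\<D>. clique_model adj U \<D> \<and> card \<D> = h"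
    by (intro clique_model_grows[OF fin r big, of K "{}"]) (auto simp: clique_model_def)
  with no_model show False by blast
qed

end

section \<open>Coverings by small sets\<close>

definition covering :: "('a \<Rightarrow> 'a \<Rightarrow> bool) \<Rightarrow> 'a set \<Rightarrow> 'a set list \<Rightarrow> bool" where
  "covering adj U Ps \<longleftrightarrow> (\<forall>P\<in>set Ps. P \<subseteq> U) \<and> (\<forall>v\<in>U. \<exists>P\<in>set Ps. v \<in> P) \<and>
     (\<forall>u\<in>U. \<forall>w\<in>U. adj u w \<longrightarrow> (\<exists>P\<in>set Ps. u \<in> P \<and> w \<in> P))"

lemma covering_append:
  assumes "covering adj (Y \<union> P) Ps" "covering adj (Y \<union> Q) Qs" "separation adj W Y P Q"
    and sym: "\<And>u w. adj u w \<Longrightarrow> adj w u"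
  shows "covering adj W (Ps @ Qs)"
proof -
  have W: "W = Y \<union> P \<union> Q" and no: "\<And>u w. u \<in> P \<Longrightarrow> w \<in> Q \<Longrightarrow> \<not> adj u w"
    using assms(3) by (auto simp: separation_def)
  have edge: "\<exists>R\<in>set (Ps @ Qs). u \<in> R \<and> w \<in> R" if "u \<in> W" "w \<in> W" "adj u w" for u w
  proof (cases "u \<in> Y \<union> P \<and> w \<in> Y \<union> P")
    case True
    with assms(1) that(3) have "\<exists>R\<in>set Ps. u \<in> R \<and> w \<in> R" unfolding covering_def by simp
    then show ?thesis by auto
  next
    case False
    with that no[of u w] no[of w u] sym[OF that(3)] have "u \<in> Y \<union> Q" "w \<in> Y \<union> Q"
      unfolding W by auto
    with assms(2) that(3) have "\<exists>R\<in>set Qs. u \<in> R \<and> w \<in> R" unfolding covering_def by simp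
    then show ?thesis by auto
  qed
  have vertex: "\<exists>R\<in>set (Ps @ Qs). v \<in> R" if "v \<in> W" for v
  proof (cases "v \<in> Y \<union> P")
    case True
    with assms(1) have "\<exists>R\<in>set Ps. v \<in> R" unfolding covering_def by simp
    then show ?thesis by auto
  next
    case False
    with that have "v \<in> Y \<union> Q" unfolding W by auto
    with assms(2) have "\<exists>R\<in>set Qs. v \<in> R" unfolding covering_def by simp
    then show ?thesis by auto
  qed
  have "R \<subseteq> W" if "R \<in> set (Ps @ Qs)" for R
    using that assms(1,2) unfolding covering_def W by (auto dest!: bspec)
  with edge vertex show ?thesis unfolding covering_def by simp
qed

text \<open>Since \<open>1.15\<^sup>2 = 1.3225 \<le> 4/3\<close>. Adding this up for two parts that
  together have at least \<open>n\<close> vertices shows that the sum of their roots exceeds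
  \<open>sqrt n\<close> by 15 percent.\<close>

lemma mult_le_sqrt_mult:
  assumes "0 \<le> m" "m \<le> 3/4 * n"
  shows "1.15 * m \<le> sqrt m * sqrt (n::real)"
proof -
  have "1.3225 * m * m \<le> n * m" using assms by (intro mult_right_mono) auto
  then have "(1.15 * m)\<^sup>2 \<le> m * n" by (simp add: power2_eq_square algebra_simps)
  then have "1.15 * m \<le> sqrt (m * n)" by (rule real_le_rsqrt)
  then show ?thesis by (simp add: real_sqrt_mult)
qed

text \<open>The term \<open>14 c \<surd>n\<close> pays for the separators: since \<open>\<surd>n\<close> grows by a constant factor when
  \<open>n\<close> is split in a balanced way, it absorbs the \<open>c \<surd>n\<close> vertices counted twice.\<close>

lemma large_covering_exists:
  fixes c \<delta> :: real and N :: nat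
  assumes sym: "\<And>u w. adj u w \<Longrightarrow> adj w u" and fin: "finite U"
  assumes c: "c \<ge> 1" and \<delta>: "0 < \<delta>" "\<delta> \<le> 1" and N: "14 * c \<le> \<delta> * sqrt N"
  assumes sep: "\<And>W. W \<subseteq> U \<Longrightarrow> W \<noteq> {} \<Longrightarrow> \<exists>Y P Q. separation adj W Y P Q \<and>
      real (card Y) \<le> c * sqrt (card W) \<and> 3 * card P \<le> 2 * card W \<and> 3 * card Q \<le> 2 * card W"
  assumes "W \<subseteq> U" "N \<le> card W"
  shows "\<exists>Ps. covering adj W Ps \<and> (\<forall>P\<in>set Ps. card P \<le> 3 * N) \<and>
    (\<Sum>P\<leftarrow>Ps. real (card P)) \<le> (1 + \<delta>) * card W - 14 * c * sqrt (card W)"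
  using assms(8-)
proof (induction "card W" arbitrary: W rule: less_induct)
  case less
  define n where "n = real (card W)"
  define t where "t = sqrt n"
  have t2: "t * t = n" unfolding t_def n_def by simp
  have "sqrt N \<le> t" unfolding t_def n_def using less.prems by simp
  then have \<delta>t: "14 * c \<le> \<delta> * t" using N \<delta>(1) by (meson mult_left_mono order_less_imp_le order_trans)
  have t0: "t \<ge> 0" unfolding t_def n_def by simp
  have "\<delta> * t \<le> 1 * t" using \<delta> t0 by (intro mult_right_mono) auto
  then have ct: "14 * c \<le> t" using \<delta>t by simp
  then have tpos: "t > 0" using c by simp
  show ?case
  proof (cases "card W \<le> 3 * N")
    case True
    \<comment> \<open>A single set needs no separator, and the slack \<open>\<delta> * n\<close>
      alone covers the root term because \<open>n\<close> is at least \<open>N\<close>.\<close>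
    have "14 * c * t \<le> \<delta> * t * t" using \<delta>t t0 by (intro mult_right_mono)
    then have le: "(\<Sum>P\<leftarrow>[W]. real (card P)) \<le> (1 + \<delta>) * n - 14 * c * t"
      using t2 unfolding n_def by (simp add: algebra_simps)
    show ?thesis
    proof (rule exI[of _ "[W]"], intro conjI)
      show "covering adj W [W]" by (auto simp: covering_def)
      show "\<forall>P\<in>set [W]. card P \<le> 3 * N" using True by simp
      show "(\<Sum>P\<leftarrow>[W]. real (card P)) \<le> (1 + \<delta>) * card W - 14 * c * sqrt (card W)"
        using le unfolding t_def n_def .
    qed
  next
    case False
    have finW: "finite W" by (rule finite_subset[OF less.prems(1) fin])
    have "W \<noteq> {}" using False by auto
    from sep[OF less.prems(1) this] obtain Y P Q where
      S: "separation adj W Y P Q" "real (card Y) \<le> c * t" "3 * card P \<le> 2 * card W" "3 * card Q \<le> 2 * card W"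
      unfolding t_def n_def by blast
    have sub: "Y \<subseteq> W" "P \<subseteq> W" "Q \<subseteq> W" and W: "W = Y \<union> P \<union> Q"
      and disj: "Y \<inter> P = {}" "Y \<inter> Q = {}" "P \<inter> Q = {}" using S(1) unfolding separation_def by auto
    have fins: "finite Y" "finite P" "finite Q" using sub finW by (simp_all add: finite_subset)
    have cYP: "card (Y \<union> P) = card Y + card P" using disj fins by (simp add: card_Un_disjoint)
    have cYQ: "card (Y \<union> Q) = card Y + card Q" using disj fins by (simp add: card_Un_disjoint)
    have "(Y \<union> P) \<inter> Q = {}" using disj by blast
    then have cW: "card W = card Y + card P + card Q" unfolding W using fins cYP by (simp add: card_Un_disjoint)
    \<comment> \<open>With the separator at most a twelfth of \<open>W\<close>, each side including
      it has at most \<open>2/3 + 1/12 = 3/4\<close> of \<open>W\<close>. As the complement of the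
      other side it has at least a third, hence at least \<open>N\<close> vertices.\<close>
    have "12 * c * t \<le> t * t" using ct tpos c by (intro mult_right_mono) auto
    then have Y12: "12 * card Y \<le> card W" using S(2) t2 unfolding n_def by linarith
    have n1: "N \<le> card (Y \<union> P)" "card (Y \<union> P) < card W" "4 * card (Y \<union> P) \<le> 3 * card W"
      using False cW cYP S(3,4) Y12 by linarith+
    have n2: "N \<le> card (Y \<union> Q)" "card (Y \<union> Q) < card W" "4 * card (Y \<union> Q) \<le> 3 * card W"
      using False cW cYQ S(3,4) Y12 by linarith+
    obtain Ps where Ps: "covering adj (Y \<union> P) Ps" "\<forall>P\<in>set Ps. card P \<le> 3 * N"
      "(\<Sum>P\<leftarrow>Ps. real (card P)) \<le> (1 + \<delta>) * card (Y \<union> P) - 14 * c * sqrt (card (Y \<union> P))"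
      using less.hyps[of "Y \<union> P"] n1 sub less.prems(1) by blast
    obtain Qs where Qs: "covering adj (Y \<union> Q) Qs" "\<forall>P\<in>set Qs. card P \<le> 3 * N"
      "(\<Sum>P\<leftarrow>Qs. real (card P)) \<le> (1 + \<delta>) * card (Y \<union> Q) - 14 * c * sqrt (card (Y \<union> Q))"
      using less.hyps[of "Y \<union> Q"] n2 sub less.prems(1) by blast
    define m1 where "m1 = real (card (Y \<union> P))"
    define m2 where "m2 = real (card (Y \<union> Q))"
    have m: "m1 + m2 = n + card Y" unfolding m1_def m2_def n_def using cW cYP cYQ by simp
    have "m1 \<le> 3/4 * n" "m2 \<le> 3/4 * n"
      using n1(3) n2(3) unfolding m1_def m2_def n_def by linarith+
    then have "1.15 * m1 \<le> sqrt m1 * t" "1.15 * m2 \<le> sqrt m2 * t"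
      unfolding t_def by (intro mult_le_sqrt_mult; simp add: m1_def m2_def)+
    then have "1.15 * t * t \<le> (sqrt m1 + sqrt m2) * t" using m t2 by (simp add: algebra_simps)
    then have "1.15 * t \<le> sqrt m1 + sqrt m2" using tpos by simp
    \<comment> \<open>The origin of 14: the gain is \<open>14 * 0.15 = 2.1\<close> times
      \<open>c * t\<close>, while the second copy of \<open>Y\<close> costs at most
      \<open>2 * c * t\<close>.\<close>
    then have 1: "14 * c * (1.15 * t) \<le> 14 * c * (sqrt m1 + sqrt m2)" using c by (intro mult_left_mono) auto
    have 2: "(1 + \<delta>) * real (card Y) \<le> 2 * (c * t)" using \<delta> S(2) by (intro mult_mono) auto
    have ct0: "0 \<le> c * t" using c tpos by simp
    have 3: "(1 + \<delta>) * m1 + (1 + \<delta>) * m2 = (1 + \<delta>) * n + (1 + \<delta>) * card Y"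
      using m by (simp flip: distrib_left)
    have "(\<Sum>P\<leftarrow>Ps @ Qs. real (card P)) \<le>
        (1 + \<delta>) * m1 - 14 * c * sqrt m1 + ((1 + \<delta>) * m2 - 14 * c * sqrt m2)"
      using Ps(3) Qs(3) unfolding m1_def m2_def by simp
    also have "\<dots> = (1 + \<delta>) * n + (1 + \<delta>) * card Y - 14 * c * (sqrt m1 + sqrt m2)"
      using 3 by (simp add: algebra_simps)
    also have "\<dots> \<le> (1 + \<delta>) * n - 14 * c * t" using 1 2 ct0 by (simp add: algebra_simps)
    finally have "(\<Sum>P\<leftarrow>Ps @ Qs. real (card P)) \<le> (1 + \<delta>) * n - 14 * c * t" .
    moreover have "\<forall>P\<in>set (Ps @ Qs). card P \<le> 3 * N" using Ps(2) Qs(2) by auto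
    ultimately show ?thesis
      using covering_append[OF Ps(1) Qs(1) S(1) sym] unfolding n_def t_def by (intro exI conjI)
  qed
qed

text \<open>Taking \<open>r\<close> just above \<open>sqrt (h * card W)\<close> satisfies the size
  condition of the separation theorem. By \<open>sqrt h \<le> h\<close> and
  \<open>1 \<le> sqrt (card W)\<close> the separator has at most
  \<open>h * (h + 2) * sqrt (card W)\<close> vertices; the square is a convenient upper
  bound.\<close>

lemma separator_exists:
  assumes sym: "\<And>u w. adj u w \<Longrightarrow> adj w u" and fin: "finite W" "W \<noteq> {}"
    and no_model: "\<not> (\<exists>\<C>. clique_model adj W \<C> \<and> card \<C> = h)"
  shows "\<exists>Y P Q. separation adj W Y P Q \<and> real (card Y) \<le> real ((h + 2)\<^sup>2) * sqrt (card W) \<and>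
    3 * card P \<le> 2 * card W \<and> 3 * card Q \<le> 2 * card W"
proof -
  define r where "r = nat \<lceil>sqrt (h * card W)\<rceil> + 1"
  have r1: "sqrt (h * card W) \<le> r" unfolding r_def by linarith
  then have "real (h * card W) \<le> real r ^ 2" by (rule sqrt_le_D)
  then have "real (h * card W) \<le> real (r * r)" by (simp add: power2_eq_square)
  then have r: "h * card W \<le> r * r" "r > 0" unfolding of_nat_le_iff by (auto simp: r_def)
  obtain Y P Q where S: "separation adj W Y P Q" "card Y \<le> h * r"
    "3 * card P \<le> 2 * card W" "3 * card Q \<le> 2 * card W"
    using balanced_separation[OF sym fin(1) r(2,1) no_model] by blast
  have n1: "1 \<le> sqrt (card W)" using fin by (simp add: Suc_le_eq card_gt_0_iff)
  have "sqrt h \<le> h" by (cases h) (auto intro!: real_le_lsqrt simp: power2_eq_square)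
  then have "sqrt (h * card W) \<le> h * sqrt (card W)" by (simp add: real_sqrt_mult mult_right_mono)
  moreover have "real r \<le> sqrt (h * card W) + 2"
  proof -
    have "0 \<le> \<lceil>sqrt (h * card W)\<rceil>" by (simp add: zero_le_ceiling less_le_trans[of _ 0])
    then have "real r = \<lceil>sqrt (h * card W)\<rceil> + 1" unfolding r_def by simp
    then show ?thesis using ceiling_correct[of "sqrt (h * card W)"] by linarith
  qed
  ultimately have "real r \<le> h * sqrt (card W) + 2 * sqrt (card W)" using n1 by linarith
  then have "real r \<le> (h + 2) * sqrt (card W)" by (simp add: algebra_simps)
  then have "real h * real r \<le> (h + 2) * ((h + 2) * sqrt (card W))" by (intro mult_mono) auto
  moreover have "real (card Y) \<le> real h * real r" using S(2) by (metis of_nat_le_iff of_nat_mult)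
  ultimately have "real (card Y) \<le> real ((h + 2)\<^sup>2) * sqrt (card W)"
    by (simp add: power2_eq_square algebra_simps)
  with S show ?thesis by blast
qed

text \<open>For \<open>\<delta> = 1 / (3 * k)\<close> and \<open>c = (h + 2)\<^sup>2\<close>, the
  requirement \<open>14 * c \<le> \<delta> * sqrt N\<close> holds with equality at
  \<open>sqrt N = 42 * c * k\<close>. A set with fewer than \<open>N\<close> vertices covers
  itself.\<close>

lemma covering_exists:
  assumes sym: "\<And>u w. adj u w \<Longrightarrow> adj w u" and fin: "finite U"
    and no_model: "\<not> (\<exists>\<C>. clique_model adj U \<C> \<and> card \<C> = h)" and k: "k > 0"
  shows "\<exists>Ps. covering adj U Ps \<and> (\<forall>P\<in>set Ps. card P \<le> 3 * (42 * (h + 2)\<^sup>2 * k)\<^sup>2) \<and>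
    (\<Sum>P\<leftarrow>Ps. real (card P)) \<le> (1 + 1 / (3 * real k)) * card U"
proof -
  define N where "N = (42 * (h + 2)\<^sup>2 * k)\<^sup>2"
  define c where "c = real ((h + 2)\<^sup>2)"
  define \<delta> where "\<delta> = 1 / (3 * real k)"
  have "1 \<le> (h + 2)\<^sup>2" by simp
  then have c: "1 \<le> c" unfolding c_def by (metis of_nat_1 of_nat_le_iff)
  have \<delta>: "0 < \<delta>" "\<delta> \<le> 1" unfolding \<delta>_def using k by (auto simp: field_simps)
  have "sqrt N = 42 * c * k" unfolding N_def c_def by simp
  then have N: "14 * c \<le> \<delta> * sqrt N" unfolding \<delta>_def using k by simp
  show ?thesis
  proof (cases "N \<le> card U")
    case True
    have sep: "\<exists>Y P Q. separation adj W Y P Q \<and> real (card Y) \<le> c * sqrt (card W) \<and>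
        3 * card P \<le> 2 * card W \<and> 3 * card Q \<le> 2 * card W" if W: "W \<subseteq> U" "W \<noteq> {}" for W
    proof -
      have "clique_model adj U \<C>" if "clique_model adj W \<C>" for \<C>
        using that W(1) by (auto simp: clique_model_def)
      then have "\<not> (\<exists>\<C>. clique_model adj W \<C> \<and> card \<C> = h)" using no_model by blast
      from separator_exists[OF sym finite_subset[OF W(1) fin] W(2) this] show ?thesis
        unfolding c_def by blast
    qed
    obtain Ps where Ps: "covering adj U Ps" "\<forall>P\<in>set Ps. card P \<le> 3 * N"
      "(\<Sum>P\<leftarrow>Ps. real (card P)) \<le> (1 + \<delta>) * card U - 14 * c * sqrt (card U)"
      using large_covering_exists[OF sym fin c \<delta> N sep order_refl True] by blast
    have "0 \<le> 14 * c * sqrt (card U)" using c by simp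
    with Ps show ?thesis unfolding N_def \<delta>_def by (intro exI[of _ Ps]) auto
  next
    case False
    have "covering adj U [U]" by (auto simp: covering_def)
    moreover have "1 * real (card U) \<le> (1 + \<delta>) * card U" using \<delta> by (intro mult_right_mono) auto
    ultimately show ?thesis using False unfolding N_def \<delta>_def by (intro exI[of _ "[U]"]) auto
  qed
qed

section \<open>Locally optimal vertex covers\<close>

lemma sum_list_card_eq_sum_length_filter:
  assumes "finite A" "\<And>P. P \<in> set Ps \<Longrightarrow> F P \<subseteq> A"
  shows "(\<Sum>P\<leftarrow>Ps. card (F P)) = (\<Sum>a\<in>A. length (filter (\<lambda>P. a \<in> F P) Ps))"
  using assms(2)
proof (induction Ps)
  case (Cons P Ps)
  have "card (F P) = (\<Sum>a\<in>A. if a \<in> F P then 1 else 0)"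
    using Cons.prems[of P] assms(1) by (simp add: sum.If_cases Int_absorb1)
  then have "(\<Sum>P\<leftarrow>P # Ps. card (F P)) =
      (\<Sum>a\<in>A. (if a \<in> F P then 1 else 0) + length (filter (\<lambda>P. a \<in> F P) Ps))"
    using Cons by (simp add: sum.distrib)
  also have "\<dots> = (\<Sum>a\<in>A. length (filter (\<lambda>P. a \<in> F P) (P # Ps)))"
    by (intro sum.cong) auto
  finally show ?case .
qed simp

text \<open>A vertex of \<open>A = X - Y\<close> that occurs only once in the covering has all its
  neighbours in that one set, so it is counted in \<open>F P\<close> as well. Thus every vertex of
  \<open>A\<close> contributes at least 2 to the sum of
  \<open>card (F P) + card (A \<inter> P)\<close>. Replacing \<open>card (F P)\<close> by
  \<open>card (B \<inter> P)\<close> turns this sum into the total size of the covering, whence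
  \<open>2 * card A \<le> (1 + \<delta>) * (card A + card B)\<close>.\<close>

lemma local_optimum_bound:
  fixes \<delta> :: real
  assumes fin: "finite V" and X: "X \<subseteq> V" "\<And>u w. adj u w \<Longrightarrow> u \<in> X \<or> w \<in> X"
    and Y: "Y \<subseteq> V" "\<And>u w. adj u w \<Longrightarrow> u \<in> Y \<or> w \<in> Y"
    and sym: "\<And>u w. adj u w \<Longrightarrow> adj w u"
    and opt: "\<And>Z. Z \<subseteq> V \<Longrightarrow> (\<And>u w. adj u w \<Longrightarrow> u \<in> Z \<or> w \<in> Z) \<Longrightarrow>
        card (X - Z \<union> (Z - X)) \<le> R \<Longrightarrow> card X \<le> card Z"
    and Ps: "covering adj (X - Y \<union> (Y - X)) Ps" "\<And>P. P \<in> set Ps \<Longrightarrow> card P \<le> R"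
      "(\<Sum>P\<leftarrow>Ps. real (card P)) \<le> (1 + \<delta>) * card (X - Y \<union> (Y - X))"
  shows "real (card X) \<le> card Y + \<delta> * card (X - Y \<union> (Y - X))"
proof -
  define A where "A = X - Y"
  define B where "B = Y - X"
  define U where "U = A \<union> B"
  have U: "X - Y \<union> (Y - X) = U" by (simp add: U_def A_def B_def)
  have fins: "finite X" "finite Y" using X(1) Y(1) fin by (simp_all add: finite_subset)
  then have finAB: "finite A" "finite B" "finite U" by (auto simp: A_def B_def U_def)
  define F where "F P = {a \<in> A \<inter> P. \<forall>b\<in>U. adj a b \<longrightarrow> b \<in> P}" for P
  have PU: "P \<subseteq> U" if "P \<in> set Ps" for P using Ps(1) that unfolding U covering_def by blast
  have F_le: "card (F P) \<le> card (B \<inter> P)" if P: "P \<in> set Ps" for P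
  proof -
    \<comment> \<open>A neighbour of a removed vertex lies in \<open>Y\<close>. If it is in
      \<open>X\<close> too, it is kept; otherwise it is in \<open>B\<close>, and by the choice of
      \<open>F P\<close> also in \<open>P\<close>, so it is added.\<close>
    define Z where "Z = (X - F P) \<union> (B \<inter> P)"
    have "u \<in> Z \<or> w \<in> Z" if "adj u w" "u \<in> X" for u w
    proof (cases "u \<in> F P")
      case True
      then have "w \<in> Y" using Y(2)[OF that(1)] unfolding F_def A_def by blast
      then have "w \<in> X - F P \<or> w \<in> B" unfolding F_def A_def B_def by blast
      moreover have "w \<in> P" if "w \<in> B" using True that \<open>adj u w\<close> unfolding F_def U_def by blast
      ultimately show ?thesis unfolding Z_def by blast
    qed (use that in \<open>auto simp: Z_def\<close>)
    then have cover: "u \<in> Z \<or> w \<in> Z" if "adj u w" for u w using X(2)[OF that] sym that by blast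
    have "X - Z \<union> (Z - X) \<subseteq> P" unfolding Z_def F_def B_def by blast
    then have "card (X - Z \<union> (Z - X)) \<le> card P"
      by (intro card_mono finite_subset[OF PU[OF P] finAB(3)])
    also have "\<dots> \<le> R" using Ps(2)[OF P] .
    finally have "card X \<le> card Z"
      using X(1) Y(1) cover by (intro opt) (auto simp: Z_def B_def)
    moreover have "card Z \<le> card (X - F P) + card (B \<inter> P)" unfolding Z_def by (rule card_Un_le)
    moreover have "card (X - F P) + card (F P) = card X"
      using fins(1) by (metis (no_types, lifting) A_def F_def Diff_subset Int_lower1 card_Diff_subset
          card_mono finite_subset le_add_diff_inverse2 mem_Collect_eq subset_iff)
    ultimately show ?thesis by linarith
  qed
  define cnt where "cnt a = length (filter (\<lambda>P. a \<in> F P) Ps)" for a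
  define mul where "mul a = length (filter (\<lambda>P. a \<in> A \<inter> P) Ps)" for a
  have "2 \<le> cnt a + mul a" if a: "a \<in> A" for a
  proof -
    obtain P where P: "P \<in> set Ps" "a \<in> P"
      using Ps(1) a unfolding U covering_def U_def by blast
    then have Pin: "P \<in> set (filter (\<lambda>P. a \<in> A \<inter> P) Ps)" using a by simp
    then have ne: "filter (\<lambda>P. a \<in> A \<inter> P) Ps \<noteq> []" by (metis empty_iff empty_set)
    show ?thesis
    proof (cases "2 \<le> mul a")
      case False
      then have "length (filter (\<lambda>P. a \<in> A \<inter> P) Ps) = 1"
        using length_0_conv[of "filter (\<lambda>P. a \<in> A \<inter> P) Ps"] ne unfolding mul_def by linarith
      then obtain P' where P': "filter (\<lambda>P. a \<in> A \<inter> P) Ps = [P']"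
        by (metis One_nat_def length_0_conv length_Suc_conv)
      have uniq: "Q = P" if "Q \<in> set Ps" "a \<in> Q" for Q
      proof -
        have "Q \<in> set (filter (\<lambda>P. a \<in> A \<inter> P) Ps)" using that a by simp
        with Pin show ?thesis unfolding P' by simp
      qed
      have "b \<in> P" if "b \<in> U" "adj a b" for b
      proof -
        have "a \<in> U" using a by (simp add: U_def)
        with that Ps(1) obtain Q where "Q \<in> set Ps" "a \<in> Q" "b \<in> Q" unfolding U covering_def by blast
        with uniq show ?thesis by blast
      qed
      then have "a \<in> F P" using a P(2) by (simp add: F_def)
      then have "P \<in> set (filter (\<lambda>P. a \<in> F P) Ps)" using P(1) by simp
      then have "cnt a \<ge> 1" unfolding cnt_def by (metis Suc_leI One_nat_def empty_iff empty_set length_greater_0_conv)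
      moreover have "mul a \<ge> 1" using ne unfolding mul_def by (simp add: Suc_le_eq)
      ultimately show ?thesis by simp
    qed simp
  qed
  then have "(\<Sum>a\<in>A. 2) \<le> (\<Sum>a\<in>A. cnt a + mul a)" by (rule sum_mono)
  then have "2 * card A \<le> (\<Sum>P\<leftarrow>Ps. card (F P)) + (\<Sum>P\<leftarrow>Ps. card (A \<inter> P))"
    using sum_list_card_eq_sum_length_filter[OF finAB(1), of Ps F]
      sum_list_card_eq_sum_length_filter[OF finAB(1), of Ps "\<lambda>P. A \<inter> P"]
    unfolding cnt_def mul_def by (simp add: sum.distrib F_def subset_iff)
  also have "\<dots> \<le> (\<Sum>P\<leftarrow>Ps. card (B \<inter> P)) + (\<Sum>P\<leftarrow>Ps. card (A \<inter> P))"
    using F_le by (intro add_right_mono sum_list_mono)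
  also have "\<dots> = (\<Sum>P\<leftarrow>Ps. card P)"
  proof -
    have "card (B \<inter> P) + card (A \<inter> P) = card P" if "P \<in> set Ps" for P
    proof -
      have "card (B \<inter> P) + card (A \<inter> P) = card (B \<inter> P \<union> A \<inter> P)"
        using finAB by (intro card_Un_disjoint[symmetric]) (auto simp: A_def B_def)
      also have "B \<inter> P \<union> A \<inter> P = P" using PU[OF that] unfolding U_def by blast
      finally show ?thesis .
    qed
    then show ?thesis by (simp add: sum_list_addf[symmetric] cong: map_cong)
  qed
  finally have "2 * real (card A) \<le> real (\<Sum>P\<leftarrow>Ps. card P)" by linarith
  also have "\<dots> = (\<Sum>P\<leftarrow>Ps. real (card P))" by (induction Ps) auto
  also have "\<dots> \<le> (1 + \<delta>) * card U" using Ps(3) unfolding U .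
  also have "card U = card A + card B"
    unfolding U_def using finAB by (intro card_Un_disjoint) (auto simp: A_def B_def)
  finally have "real (card A) \<le> card B + \<delta> * card U"
    using \<open>card U = card A + card B\<close> by (simp add: algebra_simps)
  moreover have "card X = card (X \<inter> Y) + card A" "card Y = card (X \<inter> Y) + card B"
    unfolding A_def B_def using fins by (metis card_Int_Diff, metis Int_commute card_Int_Diff)
  ultimately show ?thesis unfolding U by simp
qed

text \<open>The symmetric difference has at most \<open>card X + card Y\<close> elements, which
  gives the ratio \<open>(1 + \<delta>) / (1 - \<delta>)\<close>. This is at most
  \<open>1 + 3 * \<delta>\<close> as long as \<open>3 * \<delta> \<le> 1\<close>; hence the choice
  \<open>\<delta> = 1 / (3 * k)\<close>.\<close>

theorem local_optimum_ratio:
  assumes fin: "finite V" and X: "X \<subseteq> V" "\<And>u w. adj u w \<Longrightarrow> u \<in> X \<or> w \<in> X"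
    and Y: "Y \<subseteq> V" "\<And>u w. adj u w \<Longrightarrow> u \<in> Y \<or> w \<in> Y"
    and sym: "\<And>u w. adj u w \<Longrightarrow> adj w u"
    and no_model: "\<not> (\<exists>\<C>. clique_model adj V \<C> \<and> card \<C> = h)" and k: "k > 0"
    and opt: "\<And>Z. Z \<subseteq> V \<Longrightarrow> (\<And>u w. adj u w \<Longrightarrow> u \<in> Z \<or> w \<in> Z) \<Longrightarrow>
        card (X - Z \<union> (Z - X)) \<le> 3 * (42 * (h + 2)\<^sup>2 * k)\<^sup>2 \<Longrightarrow> card X \<le> card Z"
  shows "real (card X) \<le> (1 + 1 / k) * card Y"
proof -
  let ?U = "X - Y \<union> (Y - X)"
  define \<delta> where "\<delta> = 1 / (3 * real k)"
  have \<delta>: "0 < \<delta>" "3 * \<delta> \<le> 1" "1 / k = 3 * \<delta>" unfolding \<delta>_def using k by (auto simp: field_simps)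
  have UV: "?U \<subseteq> V" using X Y by blast
  have finU: "finite ?U" by (rule finite_subset[OF UV fin])
  have "clique_model adj V \<C>" if "clique_model adj ?U \<C>" for \<C>
    using that UV unfolding clique_model_def by (meson subset_trans)
  then have "\<not> (\<exists>\<C>. clique_model adj ?U \<C> \<and> card \<C> = h)" using no_model by blast
  from covering_exists[OF sym finU this k] obtain Ps where Ps: "covering adj ?U Ps"
    "\<forall>P\<in>set Ps. card P \<le> 3 * (42 * (h + 2)\<^sup>2 * k)\<^sup>2"
    "(\<Sum>P\<leftarrow>Ps. real (card P)) \<le> (1 + \<delta>) * card ?U" unfolding \<delta>_def by blast
  have "real (card X) \<le> card Y + \<delta> * card ?U"
    using Ps(2) by (intro local_optimum_bound[OF fin X Y sym opt Ps(1) _ Ps(3)]) auto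
  also have "\<dots> \<le> card Y + \<delta> * (real (card X) + real (card Y))"
  proof -
    have "card ?U \<le> card (X - Y) + card (Y - X)" by (rule card_Un_le)
    also have "\<dots> \<le> card X + card Y"
      using X(1) Y(1) fin by (intro add_mono card_mono) (auto intro: finite_subset)
    finally show ?thesis using \<delta>(1) by simp
  qed
  finally have 1: "(1 - \<delta>) * card X \<le> (1 + \<delta>) * card Y" by (simp add: algebra_simps)
  have "\<delta> * (3 * \<delta>) \<le> \<delta> * 1" using \<delta> by (intro mult_left_mono) auto
  then have "1 + \<delta> \<le> (1 - \<delta>) * (1 + 3 * \<delta>)" by (simp add: algebra_simps)
  then have "(1 + \<delta>) * card Y \<le> (1 - \<delta>) * (1 + 3 * \<delta>) * card Y" by (rule mult_right_mono) simp
  with 1 have "(1 - \<delta>) * card X \<le> (1 - \<delta>) * ((1 + 3 * \<delta>) * card Y)" by (simp add: mult.assoc)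
  then show ?thesis using \<delta> by simp
qed

section \<open>Clique models and minors\<close>

definition adjacent :: "'a graph \<Rightarrow> 'a \<Rightarrow> 'a \<Rightarrow> bool" where
  "adjacent G u w \<longleftrightarrow> {u, w} \<in> edges G"

text \<open>Contractions never delete edges between different branch sets, so surplus edges and
  vertices must be gone beforehand. This form is preserved by contractions inside branch sets and
  becomes an isomorphism once these are singletons.\<close>

definition exact_model :: "'b graph \<Rightarrow> 'a graph \<Rightarrow> ('b \<Rightarrow> 'a set) \<Rightarrow> bool" where
  "exact_model H G \<phi> \<longleftrightarrow> simple_graph G \<and> verts G = (\<Union>v\<in>verts H. \<phi> v) \<and>
    (\<forall>v\<in>verts H. conn (adjacent G) (\<phi> v)) \<and>
    (\<forall>v\<in>verts H. \<forall>w\<in>verts H. v \<noteq> w \<longrightarrow> \<phi> v \<inter> \<phi> w = {}) \<and>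
    (\<forall>v\<in>verts H. \<forall>w\<in>verts H. v \<noteq> w \<longrightarrow>
      ({v, w} \<in> edges H \<longleftrightarrow> (\<exists>x\<in>\<phi> v. \<exists>y\<in>\<phi> w. {x, y} \<in> edges G)))"

lemma exact_modelD:
  assumes "exact_model H G \<phi>"
  shows "simple_graph G" "verts G = (\<Union>v\<in>verts H. \<phi> v)"
    "u \<in> verts H \<Longrightarrow> conn (adjacent G) (\<phi> u)"
    "u \<in> verts H \<Longrightarrow> w \<in> verts H \<Longrightarrow> u \<noteq> w \<Longrightarrow> \<phi> u \<inter> \<phi> w = {}"
    "u \<in> verts H \<Longrightarrow> w \<in> verts H \<Longrightarrow> u \<noteq> w \<Longrightarrow>
      {u, w} \<in> edges H \<longleftrightarrow> (\<exists>x\<in>\<phi> u. \<exists>y\<in>\<phi> w. {x, y} \<in> edges G)"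
  using assms unfolding exact_model_def by simp_all

lemma simple_graph_edgeE:
  assumes "simple_graph G" "e \<in> edges G"
  obtains x y where "e = {x, y}" "x \<noteq> y" "x \<in> verts G" "y \<in> verts G"
  using assms unfolding simple_graph_def by (metis card_2_iff insert_subset)

lemma simple_graph_adjacentD:
  assumes "simple_graph G" "{x, y} \<in> edges G"
  shows "x \<noteq> y" "x \<in> verts G" "y \<in> verts G"
  using assms unfolding simple_graph_def by (fastforce simp: card_insert_if)+

lemma exact_model_singletons:
  assumes H: "simple_graph H" and M: "exact_model H G \<phi>" and one: "\<And>v. v \<in> verts H \<Longrightarrow> \<exists>x. \<phi> v = {x}"
  shows "graph_iso G H"
proof -
  define g where "g v = the_elem (\<phi> v)" for v
  have g: "\<phi> v = {g v}" if v: "v \<in> verts H" for v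
  proof -
    obtain x where "\<phi> v = {x}" using one[OF v] by (elim exE)
    then show ?thesis unfolding g_def by (simp only: the_elem_eq)
  qed
  have inj: "inj_on g (verts H)"
  proof (rule inj_onI)
    fix v w assume vw: "v \<in> verts H" "w \<in> verts H" "g v = g w"
    show "v = w"
    proof (rule ccontr)
      assume "v \<noteq> w"
      then have "\<phi> v \<inter> \<phi> w = {}" by (rule exact_modelD(4)[OF M vw(1,2)])
      with g[OF vw(1)] g[OF vw(2)] vw(3) show False by simp
    qed
  qed
  have vG: "verts G = g ` verts H" unfolding exact_modelD(2)[OF M] using g by auto
  have edge: "{v, w} \<in> edges H \<longleftrightarrow> {g v, g w} \<in> edges G" if "v \<in> verts H" "w \<in> verts H" "v \<noteq> w" for v w
    using exact_modelD(5)[OF M that] g[OF that(1)] g[OF that(2)] by simp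
  note sG = exact_modelD(1)[OF M]
  define f where "f = the_inv_into (verts H) g"
  have fg: "f (g v) = v" if "v \<in> verts H" for v unfolding f_def by (rule the_inv_into_f_f[OF inj that])
  have "edges H = (\<lambda>e. f ` e) ` edges G"
  proof (intro equalityI subsetI)
    fix e assume "e \<in> edges H"
    then obtain v w where e: "e = {v, w}" "v \<noteq> w" "v \<in> verts H" "w \<in> verts H"
      using simple_graph_edgeE[OF H] by metis
    then have "{g v, g w} \<in> edges G" using edge \<open>e \<in> edges H\<close> by simp
    moreover have "e = f ` {g v, g w}" using e fg by simp
    ultimately show "e \<in> (\<lambda>e. f ` e) ` edges G" by blast
  next
    fix e assume "e \<in> (\<lambda>e. f ` e) ` edges G"
    then obtain d where d: "d \<in> edges G" "e = f ` d" by blast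
    then obtain x y where xy: "d = {x, y}" "x \<noteq> y" "x \<in> verts G" "y \<in> verts G"
      using simple_graph_edgeE[OF sG] by metis
    then obtain v w where "x = g v" "y = g w" "v \<in> verts H" "w \<in> verts H" using vG by blast
    with xy d edge[of v w] fg show "e \<in> edges H" by auto
  qed
  moreover have "bij_betw f (verts G) (verts H)"
    unfolding f_def vG using inj by (intro bij_betw_the_inv_into) (simp add: bij_betw_def)
  ultimately show ?thesis unfolding graph_iso_def by blast
qed

text \<open>The contracted edge itself would be mapped to the loop \<open>{x}\<close>, which
  \<open>a \<noteq> b\<close> rules out.\<close>

lemma contract_edge_edges_iff:
  assumes "simple_graph G" "{x, y} \<in> edges G" "a \<noteq> b"
  shows "{a, b} \<in> edges (contract_edge G x y) \<longleftrightarrow>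
    (\<exists>a' b'. {a', b'} \<in> edges G \<and> (id(y := x)) a' = a \<and> (id(y := x)) b' = b)"
proof
  assume "{a, b} \<in> edges (contract_edge G x y)"
  then obtain e where e: "e \<in> edges G" "{a, b} = (id(y := x)) ` e" unfolding contract_edge_def by auto
  obtain p q where pq: "e = {p, q}" using simple_graph_edgeE[OF assms(1) e(1)] by metis
  have "{a, b} = {(id(y := x)) p, (id(y := x)) q}" using e(2) pq by simp
  then consider "(id(y := x)) p = a" "(id(y := x)) q = b" | "(id(y := x)) q = a" "(id(y := x)) p = b"
    unfolding doubleton_eq_iff by blast
  then show "\<exists>a' b'. {a', b'} \<in> edges G \<and> (id(y := x)) a' = a \<and> (id(y := x)) b' = b"
    using e(1) pq by cases (metis, metis insert_commute)
next
  assume "\<exists>a' b'. {a', b'} \<in> edges G \<and> (id(y := x)) a' = a \<and> (id(y := x)) b' = b"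
  then obtain a' b' where e: "{a', b'} \<in> edges G" "(id(y := x)) a' = a" "(id(y := x)) b' = b" by blast
  have "{a', b'} \<noteq> {x, y}" using e(2,3) assms(3) by (auto simp: doubleton_eq_iff split: if_splits)
  moreover have "{a, b} = (id(y := x)) ` {a', b'}" by (simp only: image_insert image_empty e(2,3))
  ultimately show "{a, b} \<in> edges (contract_edge G x y)"
    using e(1) unfolding contract_edge_def by simp
qed

lemma simple_graph_contract_edge:
  assumes "simple_graph G" "{x, y} \<in> edges G"
  shows "simple_graph (contract_edge G x y)"
  unfolding simple_graph_def
proof (intro conjI ballI)
  show "finite (verts (contract_edge G x y))"
    using assms(1) unfolding simple_graph_def contract_edge_def by simp
next
  fix e assume "e \<in> edges (contract_edge G x y)"
  then obtain d where d: "d \<in> edges G" "d \<noteq> {x, y}" "e = (id(y := x)) ` d"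
    unfolding contract_edge_def by auto
  then obtain p q where pq: "d = {p, q}" "p \<noteq> q" "p \<in> verts G" "q \<in> verts G"
    using simple_graph_edgeE[OF assms(1)] by metis
  note xy = simple_graph_adjacentD[OF assms]
  show "e \<subseteq> verts (contract_edge G x y)" using d(3) pq xy unfolding contract_edge_def by auto
  have "(id(y := x)) p \<noteq> (id(y := x)) q" using d(2) pq xy by auto
  moreover have "e = {(id(y := x)) p, (id(y := x)) q}"
    by (simp only: d(3) pq(1) image_insert image_empty)
  ultimately show "card e = 2" unfolding card_2_iff by blast
qed

text \<open>The new branch sets are the images of the old ones under \<open>id(y := x)\<close>.
  Preimages of closed sets are closed, which transfers connectedness.\<close>

lemma exact_model_contract_edge:
  assumes M: "exact_model H G \<phi>" and v: "v \<in> verts H" "x \<in> \<phi> v" "y \<in> \<phi> v" "{x, y} \<in> edges G"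
  shows "exact_model H (contract_edge G x y) (\<phi>(v := \<phi> v - {y}))"
proof -
  let ?G = "contract_edge G x y" and ?\<psi> = "\<phi>(v := \<phi> v - {y})"
  note sG = exact_modelD(1)[OF M] and vG = exact_modelD(2)[OF M] and cn = exact_modelD(3)[OF M]
    and dj = exact_modelD(4)[OF M] and ed = exact_modelD(5)[OF M]
  have xy: "x \<noteq> y" using simple_graph_adjacentD[OF sG v(4)] by simp
  let ?f = "id(y := x)"
  note eiff = contract_edge_edges_iff[OF sG v(4)]
  have y_only: "y \<notin> \<phi> u" if "u \<in> verts H" "u \<noteq> v" for u using dj[OF that(1) v(1) that(2)] v(3) by blast
  have img: "?\<psi> u = ?f ` \<phi> u" if "u \<in> verts H" for u
  proof (cases "u = v")
    case True
    then show ?thesis using v xy by auto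
  next
    case False
    then show ?thesis using y_only[OF that False] by auto
  qed
  have dj': "?\<psi> u \<inter> ?\<psi> w = {}" if "u \<in> verts H" "w \<in> verts H" "u \<noteq> w" for u w
    using dj[OF that] by auto
  have sG': "simple_graph ?G" by (rule simple_graph_contract_edge[OF sG v(4)])
  moreover have "verts ?G = (\<Union>v\<in>verts H. ?\<psi> v)"
  proof -
    have "verts ?G = verts G - {y}" by (simp add: contract_edge_def)
    also have "\<dots> = (\<Union>u\<in>verts H. \<phi> u - {y})" unfolding vG by blast
    also have "\<dots> = (\<Union>u\<in>verts H. ?\<psi> u)" using y_only by (intro SUP_cong) auto
    finally show ?thesis .
  qed
  moreover have "conn (adjacent ?G) (?\<psi> u)" if u: "u \<in> verts H" for u
    unfolding conn_def
  proof (intro conjI allI impI)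
    show "?\<psi> u \<noteq> {}" using img[OF u] conn_nonempty[OF cn[OF u]] by blast
  next
    fix P assume P: "P \<noteq> {}" "closed_in (adjacent ?G) (?\<psi> u) P"
    define Q where "Q = {z \<in> \<phi> u. ?f z \<in> P}"
    have "closed_in (adjacent G) (\<phi> u) Q"
      unfolding closed_in_def
    proof (intro conjI ballI impI)
      fix a b assume ab: "a \<in> Q" "b \<in> \<phi> u" "adjacent G a b"
      have fb: "?f b \<in> ?\<psi> u" "?f a \<in> P" using ab img[OF u] unfolding Q_def by blast+
      have "?f b \<in> P"
      proof (cases "?f a = ?f b")
        case False
        then have "adjacent ?G (?f a) (?f b)"
          using ab(3) eiff[OF False] unfolding adjacent_def by blast
        then show ?thesis using P(2) fb unfolding closed_in_def by blast
      qed (use fb in simp)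
      then show "b \<in> Q" using ab(2) unfolding Q_def by simp
    qed (simp add: Q_def)
    moreover have "Q \<noteq> {}"
    proof -
      obtain p where "p \<in> P" using P(1) by blast
      then have "p \<in> ?f ` \<phi> u" using P(2) img[OF u] unfolding closed_in_def by blast
      with \<open>p \<in> P\<close> show ?thesis unfolding Q_def by blast
    qed
    ultimately have "Q = \<phi> u" by (rule connD[OF cn[OF u]])
    then have "?f ` \<phi> u \<subseteq> P" unfolding Q_def by blast
    then have "?\<psi> u \<subseteq> P" by (simp only: img[OF u])
    moreover have "P \<subseteq> ?\<psi> u" using P(2) by (simp only: closed_in_def)
    ultimately show "P = ?\<psi> u" by (intro equalityI)
  qed
  moreover have "{u, w} \<in> edges H \<longleftrightarrow> (\<exists>a\<in>?\<psi> u. \<exists>b\<in>?\<psi> w. {a, b} \<in> edges ?G)"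
    if uw: "u \<in> verts H" "w \<in> verts H" "u \<noteq> w" for u w
  proof
    assume "{u, w} \<in> edges H"
    then obtain a b where ab: "a \<in> \<phi> u" "b \<in> \<phi> w" "{a, b} \<in> edges G" using ed[OF uw] by blast
    have "?f a \<in> ?\<psi> u" "?f b \<in> ?\<psi> w" using ab img uw by blast+
    moreover from this have "?f a \<noteq> ?f b" using dj'[OF uw] by (metis IntI empty_iff)
    ultimately show "\<exists>a\<in>?\<psi> u. \<exists>b\<in>?\<psi> w. {a, b} \<in> edges ?G" using eiff ab(3) by blast
  next
    assume "\<exists>a\<in>?\<psi> u. \<exists>b\<in>?\<psi> w. {a, b} \<in> edges ?G"
    then obtain a b where ab: "a \<in> ?\<psi> u" "b \<in> ?\<psi> w" "{a, b} \<in> edges ?G" by blast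
    then have "a \<noteq> b" using dj'[OF uw] by (metis IntI empty_iff)
    from ab(3)[unfolded eiff[OF this]] show "{u, w} \<in> edges H"
    proof (elim exE conjE)
      fix a' b' assume e: "{a', b'} \<in> edges G" "?f a' = a" "?f b' = b"
      have in_part: "z \<in> \<phi> u'" if z: "z \<in> verts G" "?f z \<in> ?\<psi> u'" "u' \<in> verts H" for z u'
      proof -
        obtain w' where w': "w' \<in> verts H" "z \<in> \<phi> w'" using z(1) unfolding vG by (rule UN_E)
        have "?f z \<in> ?\<psi> w'" unfolding img[OF w'(1)] using w'(2) by (rule imageI)
        then have "w' = u'" using dj'[OF w'(1) z(3)] z(2) by (metis IntI empty_iff)
        with w'(2) show ?thesis by (simp only:)
      qed
      note G_ab = simple_graph_adjacentD(2,3)[OF sG e(1)]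
      have "a' \<in> \<phi> u" by (rule in_part[OF G_ab(1) _ uw(1)]) (simp only: e(2) ab(1))
      moreover have "b' \<in> \<phi> w" by (rule in_part[OF G_ab(2) _ uw(2)]) (simp only: e(3) ab(2))
      ultimately show "{u, w} \<in> edges H" unfolding ed[OF uw] using e(1) by (intro bexI)
    qed
  qed
  ultimately show ?thesis using dj' unfolding exact_model_def by simp
qed

text \<open>In a branch set with a second vertex, connectedness prevents \<open>{x}\<close> from
  being closed. So there is an edge to contract inside, and each contraction loses a vertex.\<close>

lemma exact_model_contracts:
  assumes H: "simple_graph H"
  shows "exact_model H G \<phi> \<Longrightarrow> \<exists>G'. contraction_step\<^sup>*\<^sup>* G G' \<and> graph_iso G' H"
proof (induction "card (verts G)" arbitrary: G \<phi> rule: less_induct)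
  case less
  note M = less.prems
  show ?case
  proof (cases "\<forall>v\<in>verts H. \<exists>x. \<phi> v = {x}")
    case True
    then show ?thesis using exact_model_singletons[OF H M] by blast
  next
    case False
    then obtain v where v: "v \<in> verts H" "\<nexists>x. \<phi> v = {x}" by blast
    note cn = exact_modelD(3)[OF M v(1)]
    then obtain x where x: "x \<in> \<phi> v" using conn_nonempty by blast
    have "\<not> closed_in (adjacent G) (\<phi> v) {x}" using connD[OF cn, of "{x}"] v(2) by blast
    then obtain y where y: "y \<in> \<phi> v" "{x, y} \<in> edges G"
      using x unfolding closed_in_def adjacent_def by auto
    note sG = exact_modelD(1)[OF M]
    let ?G = "contract_edge G x y"
    have "card (verts ?G) < card (verts G)"
      using sG simple_graph_adjacentD(3)[OF sG y(2)] unfolding contract_edge_def simple_graph_def fst_conv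
      by (elim conjE) (intro card_Diff1_less)
    from less.hyps[OF this exact_model_contract_edge[OF M v(1) x y]]
    obtain G' where "contraction_step\<^sup>*\<^sup>* ?G G'" "graph_iso G' H" by blast
    moreover have "contraction_step G ?G" unfolding contraction_step_def using y(2) by blast
    ultimately show ?thesis by (meson converse_rtranclp_into_rtranclp)
  qed
qed

text \<open>Any bijection from the vertices of \<open>H\<close> to the branch sets will do, since
  all pairs of branch sets are adjacent. The subgraph omits the edges of \<open>G\<close> between
  branch sets whose counterparts are not adjacent in \<open>H\<close>.\<close>

lemma minor_if_clique_model:
  assumes G: "simple_graph G" and H: "simple_graph H"
    and M: "clique_model (adjacent G) (verts G) \<C>" "card \<C> = card (verts H)"
  shows "minor H G"
proof -
  have "finite (verts H)" "finite \<C>" using H M unfolding simple_graph_def clique_model_def by auto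
  then obtain \<phi> where \<phi>: "bij_betw \<phi> (verts H) \<C>" using M(2) finite_same_card_bij by metis
  have in_C: "\<phi> v \<in> \<C>" if "v \<in> verts H" for v using \<phi> that by (rule bij_betwE[rule_format])
  have inj: "\<phi> v \<noteq> \<phi> w" if "v \<in> verts H" "w \<in> verts H" "v \<noteq> w" for v w
    using \<phi> that unfolding bij_betw_def inj_on_def by blast
  have sub: "\<phi> v \<subseteq> verts G" "conn (adjacent G) (\<phi> v)" if "v \<in> verts H" for v
    using in_C[OF that] M(1) unfolding clique_model_def by simp_all
  have dj: "\<phi> v \<inter> \<phi> w = {}" "\<exists>x\<in>\<phi> v. \<exists>y\<in>\<phi> w. {x, y} \<in> edges G"
    if "v \<in> verts H" "w \<in> verts H" "v \<noteq> w" for v w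
    using in_C[OF that(1)] in_C[OF that(2)] inj[OF that] M(1) unfolding clique_model_def adjacent_def by simp_all
  define E where "E = {e \<in> edges G. (\<exists>v\<in>verts H. e \<subseteq> \<phi> v) \<or>
    (\<exists>v\<in>verts H. \<exists>w\<in>verts H. {v, w} \<in> edges H \<and> (\<exists>x\<in>\<phi> v. \<exists>y\<in>\<phi> w. e = {x, y}))}"
  define G' where "G' = ((\<Union>v\<in>verts H. \<phi> v), E)"
  have part: "u = v" if "x \<in> \<phi> u" "x \<in> \<phi> v" "u \<in> verts H" "v \<in> verts H" for x u v
    using dj(1)[of u v] that by blast
  have sG': "simple_graph G'"
    unfolding simple_graph_def
  proof (intro conjI ballI)
    show "finite (verts G')" unfolding G'_def fst_conv
      using G sub(1) finite_subset[of "\<Union>v\<in>verts H. \<phi> v" "verts G"] unfolding simple_graph_def by blast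
    fix e assume "e \<in> edges G'"
    then have e: "e \<in> E" by (simp add: G'_def)
    then show "e \<subseteq> verts G'" unfolding E_def G'_def by auto
    show "card e = 2" using e G unfolding E_def simple_graph_def by simp
  qed
  have "exact_model H G' \<phi>"
    unfolding exact_model_def
  proof (intro conjI ballI impI)
    show "simple_graph G'" by (fact sG')
    show "verts G' = (\<Union>v\<in>verts H. \<phi> v)" by (simp add: G'_def)
  next
    fix v assume v: "v \<in> verts H"
    have "closed_in (adjacent G') (\<phi> v) P \<Longrightarrow> closed_in (adjacent G) (\<phi> v) P" for P
    proof -
      have "adjacent G' a b" if "adjacent G a b" "a \<in> \<phi> v" "b \<in> \<phi> v" for a b
        using that v unfolding adjacent_def G'_def E_def by auto
      then show "closed_in (adjacent G') (\<phi> v) P \<Longrightarrow> closed_in (adjacent G) (\<phi> v) P"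
        unfolding closed_in_def by (meson subsetD)
    qed
    then show "conn (adjacent G') (\<phi> v)" using sub(2)[OF v] unfolding conn_def by blast
  next
    fix v w assume vw: "v \<in> verts H" "w \<in> verts H" "v \<noteq> w"
    show "\<phi> v \<inter> \<phi> w = {}" using dj(1)[OF vw] .
    show "{v, w} \<in> edges H \<longleftrightarrow> (\<exists>x\<in>\<phi> v. \<exists>y\<in>\<phi> w. {x, y} \<in> edges G')"
    proof
      assume "{v, w} \<in> edges H"
      moreover obtain x y where xy: "x \<in> \<phi> v" "y \<in> \<phi> w" "{x, y} \<in> edges G" using dj(2)[OF vw] by blast
      ultimately have "\<exists>v\<in>verts H. \<exists>w\<in>verts H. {v, w} \<in> edges H \<and> (\<exists>x'\<in>\<phi> v. \<exists>y'\<in>\<phi> w. {x, y} = {x', y'})"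
        using vw(1,2) by blast
      with xy(3) have "{x, y} \<in> edges G'" unfolding G'_def E_def by simp
      with xy(1,2) show "\<exists>x\<in>\<phi> v. \<exists>y\<in>\<phi> w. {x, y} \<in> edges G'" by blast
    next
      assume "\<exists>x\<in>\<phi> v. \<exists>y\<in>\<phi> w. {x, y} \<in> edges G'"
      then obtain x y where xy: "x \<in> \<phi> v" "y \<in> \<phi> w" "{x, y} \<in> E" unfolding G'_def by auto
      from xy(3) consider u where "u \<in> verts H" "{x, y} \<subseteq> \<phi> u"
        | v' w' x' y' where "v' \<in> verts H" "w' \<in> verts H" "{v', w'} \<in> edges H"
          "x' \<in> \<phi> v'" "y' \<in> \<phi> w'" "{x, y} = {x', y'}" unfolding E_def by blast
      then show "{v, w} \<in> edges H"
      proof cases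
        case 1
        then have "u = v" "u = w" using part xy vw by blast+
        with vw show ?thesis by simp
      next
        case 2
        note c = 2
        from c(6) consider "x = x'" "y = y'" | "x = y'" "y = x'" by (auto simp: doubleton_eq_iff)
        then show ?thesis
        proof cases
          case 1
          then have "v = v'" "w = w'" using part xy(1,2) vw(1,2) c(1,2,4,5) by blast+
          with c(3) show ?thesis by simp
        next
          case 2
          then have "v = w'" "w = v'" using part xy(1,2) vw(1,2) c(1,2,4,5) by blast+
          with c(3) show ?thesis by (simp add: insert_commute)
        qed
      qed
    qed
  qed
  from exact_model_contracts[OF H this] obtain G'' where
    "contraction_step\<^sup>*\<^sup>* G' G''" "graph_iso G'' H" by blast
  moreover have "subgraph G' G"
    using sG' sub(1) unfolding subgraph_def G'_def E_def by auto
  ultimately show ?thesis unfolding minor_def by blast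
qed

section \<open>The approximation scheme\<close>

lemma opt_attained:
  assumes "simple_graph G"
  shows "\<exists>Y. vertex_cover G Y \<and> card Y = opt G" and "vertex_cover G X \<Longrightarrow> opt G \<le> card X"
proof -
  let ?S = "{X. vertex_cover G X}"
  have fin: "finite (card ` ?S)"
    using assms unfolding simple_graph_def
    by (intro finite_imageI finite_subset[of ?S "Pow (verts G)"]) (auto simp: vertex_cover_def)
  have "vertex_cover G (verts G)"
    using assms unfolding vertex_cover_def simple_graph_def by blast
  then have "card ` ?S \<noteq> {}" by blast
  from Min_in[OF fin this] show "\<exists>Y. vertex_cover G Y \<and> card Y = opt G"
    unfolding opt_def by (auto simp: image_iff)
  show "vertex_cover G X \<Longrightarrow> opt G \<le> card X"
    unfolding opt_def using fin by (intro Min_le) auto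
qed

lemma local_search_close:
  assumes G: "simple_graph G" and H: "simple_graph H" "\<not> minor H G"
    and k: "k > 0" "1 / real k \<le> \<epsilon>"
    and m: "3 * (42 * (card (verts H) + 2)\<^sup>2 * k)\<^sup>2 \<le> 2 ^ m"
    and x: "codes_graph x G"
  shows "\<exists>X. codes_set (t_local_search m x) X \<and> close_solution \<epsilon> G X"
proof -
  obtain X where X: "codes_set (t_local_search m x) X" "vertex_cover G X"
    "\<And>Y. vertex_cover G Y \<Longrightarrow> card (X - Y \<union> (Y - X)) \<le> 2 ^ m \<Longrightarrow> card X \<le> card Y"
    using local_search_correct[OF x G] by blast
  obtain Y where Y: "vertex_cover G Y" "card Y = opt G" using opt_attained(1)[OF G] by blast
  have cover: "vertex_cover G Z \<longleftrightarrow> Z \<subseteq> verts G \<and> (\<forall>u w. adjacent G u w \<longrightarrow> u \<in> Z \<or> w \<in> Z)" for Z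
    unfolding vertex_cover_def adjacent_def ..
  have fin: "finite (verts G)" using G by (simp add: simple_graph_def)
  have no_model: "\<not> (\<exists>\<C>. clique_model (adjacent G) (verts G) \<C> \<and> card \<C> = card (verts H))"
    using minor_if_clique_model[OF G H(1)] H(2) by blast
  have sym: "adjacent G w u" if "adjacent G u w" for u w
    using that by (simp add: adjacent_def insert_commute)
  have ratio: "real (card X) \<le> (1 + 1 / k) * card Y"
  proof (rule local_optimum_ratio[OF fin _ _ _ _ sym no_model k(1)])
    fix Z assume Z: "Z \<subseteq> verts G" "\<And>u w. adjacent G u w \<Longrightarrow> u \<in> Z \<or> w \<in> Z"
      "card (X - Z \<union> (Z - X)) \<le> 3 * (42 * (card (verts H) + 2)\<^sup>2 * k)\<^sup>2"
    show "card X \<le> card Z"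
    proof (rule X(3))
      show "vertex_cover G Z" using Z(1,2) by (simp add: cover)
      show "card (X - Z \<union> (Z - X)) \<le> 2 ^ m" using Z(3) m by (rule le_trans)
    qed
  qed (use X(2) Y(1) in \<open>simp_all add: cover\<close>)
  also have "\<dots> \<le> (1 + \<epsilon>) * card Y" using k(2) by (intro mult_right_mono) auto
  finally have "real (card X) \<le> (1 + \<epsilon>) * opt G" using Y(2) by simp
  moreover have "(1 - \<epsilon>) * opt G \<le> 1 * real (opt G)"
  proof (rule mult_right_mono)
    have "0 < 1 / real k" using k(1) by simp
    with k(2) show "1 - \<epsilon> \<le> 1" by linarith
  qed simp
  moreover have "opt G \<le> card X" using opt_attained(2)[OF G X(2)] .
  ultimately have "close_solution \<epsilon> G X" using X(2) unfolding close_solution_def by simp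
  with X(1) show ?thesis by blast
qed

text \<open>A positive fraction is at least the inverse of its denominator, and the denominator can
  be read off from \<open>code_rat\<close> without division. An irrational \<epsilon> is never given
  to the uniform algorithm, so there the value need not be computable.\<close>

definition inverse_accuracy :: "real \<Rightarrow> nat" where
  "inverse_accuracy \<epsilon> =
    (if \<epsilon> \<in> \<rat> then nat (snd (quotient_of (inv of_rat \<epsilon>))) else nat \<lceil>1 / \<epsilon>\<rceil>)"

lemma inverse_accuracy_of_rat: "inverse_accuracy (of_rat q) = nat (snd (quotient_of q))"
proof -
  have "inj (of_rat :: rat \<Rightarrow> real)" by (rule injI) simp
  then show ?thesis unfolding inverse_accuracy_def by (simp add: Rats_def)
qed

lemma inverse_accuracy:
  assumes "\<epsilon> > 0"
  shows "inverse_accuracy \<epsilon> > 0" "1 / real (inverse_accuracy \<epsilon>) \<le> \<epsilon>"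
proof -
  have "inverse_accuracy \<epsilon> > 0 \<and> 1 / real (inverse_accuracy \<epsilon>) \<le> \<epsilon>"
  proof (cases "\<epsilon> \<in> \<rat>")
    case True
    then obtain q where q: "\<epsilon> = of_rat q" by (rule Rats_cases)
    obtain n d where nd: "quotient_of q = (n, d)" by fastforce
    have d: "d > 0" using quotient_of_denom_pos[OF nd] .
    have "q = of_int n / of_int d" using quotient_of_div[OF nd] .
    then have e: "\<epsilon> = of_int n / of_int d" unfolding q by (simp add: of_rat_divide)
    have "n > 0" using assms d unfolding e by (simp add: zero_less_divide_iff)
    then have "1 / real_of_int d \<le> \<epsilon>" unfolding e using d by (intro divide_right_mono) auto
    then show ?thesis using d unfolding q inverse_accuracy_of_rat nd by simp
  next
    case False
    define k where "k = inverse_accuracy \<epsilon>"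
    have k: "k = nat \<lceil>1 / \<epsilon>\<rceil>" using False by (simp add: k_def inverse_accuracy_def)
    have "k > 0" using assms unfolding k by simp
    moreover have "1 / \<epsilon> \<le> k" unfolding k by (rule real_nat_ceiling_ge)
    ultimately show ?thesis using assms unfolding k_def[symmetric] by (simp add: field_simps)
  qed
  then show "inverse_accuracy \<epsilon> > 0" "1 / real (inverse_accuracy \<epsilon>) \<le> \<epsilon>" by blast+
qed

theorem theorem5p3:
  fixes C :: "nat graph set"
  assumes "\<And>G. G \<in> C \<Longrightarrow> simple_graph G"
    and "has_excluded_minor C"
  shows "min_vertex_cover_has_ptas C"
proof -
  obtain H :: "nat graph" where H: "simple_graph H" "\<And>G. G \<in> C \<Longrightarrow> \<not> minor H G"
    using assms(2) unfolding has_excluded_minor_def by blast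
  obtain A where A: "\<And>m. \<exists>q. computes 0 (A m) (t_local_search m) q"
    and U: "\<And>c. \<exists>U. \<forall>q. outputs U (code_rat q)
      (code_prog (A (c + 2 * bit_length (nat (snd (quotient_of q))))))"
    using local_search_programs by blast
  define b where "b = 3 * (42 * (card (verts H) + 2)\<^sup>2)\<^sup>2"
  \<comment> \<open>The factor 2 provides the square of the inverse accuracy in the radius, and the
    first summand the constant \<open>b\<close>; at rational \<epsilon> this is the exponent
    produced by \<open>U\<close>.\<close>
  define m where "m \<epsilon> = bit_length b + 2 * bit_length (inverse_accuracy \<epsilon>)" for \<epsilon>
  have m: "3 * (42 * (card (verts H) + 2)\<^sup>2 * inverse_accuracy \<epsilon>)\<^sup>2 \<le> 2 ^ m \<epsilon>" for \<epsilon>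
  proof -
    have "b * (inverse_accuracy \<epsilon>)\<^sup>2 \<le> 2 ^ bit_length b * (2 ^ bit_length (inverse_accuracy \<epsilon>))\<^sup>2"
      by (intro mult_mono power_mono less_imp_le[OF less_two_power_bit_length]) auto
    then show ?thesis
      unfolding b_def m_def by (simp add: power_mult_distrib power_add power_even_eq mult.assoc)
  qed
  have "approximates (A (m \<epsilon>)) \<epsilon> C" if \<epsilon>: "\<epsilon> > 0" for \<epsilon>
  proof -
    obtain q where q: "computes 0 (A (m \<epsilon>)) (t_local_search (m \<epsilon>)) q" using A by blast
    have "polynomial_time (A (m \<epsilon>))"
      unfolding polynomial_time_def using computes_runs[OF q] by blast
    moreover have "outputs (A (m \<epsilon>)) x (t_local_search (m \<epsilon>) x)" for x
      unfolding outputs_def using computes_runs[OF q] by blast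
    ultimately show ?thesis
      unfolding approximates_def
      using local_search_close[OF assms(1) H(1,2) inverse_accuracy[OF \<epsilon>] m] by blast
  qed
  moreover have "\<exists>U. \<forall>q > 0. outputs U (code_rat q) (code_prog (A (m (of_rat q))))"
    using U[of "bit_length b"] unfolding m_def inverse_accuracy_of_rat by blast
  ultimately have "is_ptas (\<lambda>\<epsilon>. A (m \<epsilon>)) C" unfolding is_ptas_def by blast
  then show ?thesis unfolding min_vertex_cover_has_ptas_def by blast
qed

end
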